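(* Let $k$ be a commutative Noetherian ring, $S$ a set, and $G$ a group acting on $S$ via a group homomorphism $\rho: G \to \mathrm{Sym}(S)$. If the action of $G$ on $S$ is highly homogeneous, then $k[S]$ as a $k[S]G$-module is Noetherian.
   Context: $\mathrm{Sym}(S)$ is the group of all permutations of $S$. An action of $G$ on $S$ is highly homogeneous if for every $n\in\mathbb{N}$ the group $G$ acts transitively on the set $S^{\{n\}}$ of $n$-element subsets of $S$. $k[S] = k[x_s \mid s \in S]$ is the polynomial ring with indeterminates indexed by $S$; $G$ acts on it by $k$-algebra automorphisms via $g \cdot x_s = x_{g\cdot s}$. The skew group ring $k[S]G$ consists of finite sums of elements $ag$ ($a \in k[S]$, $g \in G$), with multiplication $(ag)(bh) = a (g\cdot b)\, gh$. Modules are left modules. *)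

theory Defs
  imports "HOL-Algebra.Group_Action" "HOL-Algebra.Indexed_Polynomials" "HOL-Library.Ramsey"
begin

section \<open>Highly homogeneous actions\<close>

definition highly_homogeneous ::
    "('g, 'n) monoid_scheme \<Rightarrow> 's set \<Rightarrow> ('g \<Rightarrow> 's \<Rightarrow> 's) \<Rightarrow> bool"
  where "highly_homogeneous G S \<rho> \<longleftrightarrow>
    (\<forall>n. \<forall>A\<in>nsets S n. \<forall>B\<in>nsets S n. \<exists>g\<in>carrier G. \<rho> g ` A = B)"


section \<open>Polynomial rings over a set of indeterminates\<close>

text \<open>The HOL-Algebra theory of indexed polynomials provides the set \<open>R[X\<^sub>s | s \<in> S]\<close>
  (finitely supported functions from monomials, which are multisets over \<open>S\<close>, to coefficients)
  together with its addition, but no general multiplication and no ring record.\<close>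

definition (in ring) indexed_mult ::
    "('c multiset \<Rightarrow> 'a) \<Rightarrow> ('c multiset \<Rightarrow> 'a) \<Rightarrow> ('c multiset \<Rightarrow> 'a)"
  where "indexed_mult p q = (\<lambda>m. \<Oplus>n\<in>{n. n \<subseteq># m}. p n \<otimes> q (m - n))"

definition (in ring) indexed_poly_ring :: "'c set \<Rightarrow> ('c multiset \<Rightarrow> 'a) ring"
  where "indexed_poly_ring S =
    \<lparr>carrier = indexed_pset S (carrier R),
     monoid.mult = indexed_mult,
     monoid.one = indexed_const \<one>,
     ring.zero = indexed_const \<zero>,
     ring.add = indexed_padd\<rparr>"

text \<open>The \<open>R\<close>-algebra map that substitutes \<open>X\<^bsub>\<pi> s\<^esub>\<close> for every \<open>X\<^sub>s\<close>: it sends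
  the monomial \<open>n\<close> to \<open>image_mset \<pi> n\<close> and is extended linearly.\<close>

definition (in ring) indexed_rename ::
    "('c \<Rightarrow> 'd) \<Rightarrow> ('c multiset \<Rightarrow> 'a) \<Rightarrow> ('d multiset \<Rightarrow> 'a)"
  where "indexed_rename \<pi> p = (\<lambda>m. \<Oplus>n\<in>{n. p n \<noteq> \<zero> \<and> image_mset \<pi> n = m}. p n)"

lemma (in ring) indexed_rename_var: "indexed_rename \<pi> (indexed_var s) = indexed_var (\<pi> s)"
proof (cases "\<one> = \<zero>")
  case True
  then show ?thesis
    by (auto simp: indexed_rename_def indexed_var_def indexed_pmult_def indexed_const_def fun_eq_iff)
next
  case False
  have var: "indexed_var i = (\<lambda>m. if m = {#i#} then \<one> else \<zero>)" for i :: 'e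
    by (auto simp: indexed_var_def indexed_pmult_def indexed_const_def fun_eq_iff
        dest: multi_member_split)
  have "{n. indexed_var s n \<noteq> \<zero> \<and> image_mset \<pi> n = m} = (if m = {#\<pi> s#} then {{#s#}} else {})" for m
    using False by (auto simp: var)
  then show ?thesis
    by (simp add: indexed_rename_def fun_eq_iff var)
qed


section \<open>Skew group rings\<close>

text \<open>An element \<open>\<Sum> a\<^sub>g g\<close> of the skew group ring is the finitely supported function
  \<open>g \<mapsto> a\<^sub>g\<close>, extended by zero outside the group. The product is the biadditive extension of
  \<open>(a g) (b h) = a (\<alpha> g b) (g h)\<close>.\<close>

definition skew_group_ring ::
    "('a, 'm) ring_scheme \<Rightarrow> ('g, 'n) monoid_scheme \<Rightarrow> ('g \<Rightarrow> 'a \<Rightarrow> 'a) \<Rightarrow> ('g \<Rightarrow> 'a) ring"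
  where "skew_group_ring A G \<alpha> =
    \<lparr>carrier = {f. range f \<subseteq> carrier A \<and> finite {g. f g \<noteq> \<zero>\<^bsub>A\<^esub>} \<and> {g. f g \<noteq> \<zero>\<^bsub>A\<^esub>} \<subseteq> carrier G},
     monoid.mult = (\<lambda>f f' x. finsum A (\<lambda>(g, h). f g \<otimes>\<^bsub>A\<^esub> \<alpha> g (f' h))
       {(g, h). f g \<noteq> \<zero>\<^bsub>A\<^esub> \<and> f' h \<noteq> \<zero>\<^bsub>A\<^esub> \<and> g \<otimes>\<^bsub>G\<^esub> h = x}),
     monoid.one = (\<lambda>x. if x = \<one>\<^bsub>G\<^esub> then \<one>\<^bsub>A\<^esub> else \<zero>\<^bsub>A\<^esub>),
     ring.zero = (\<lambda>x. \<zero>\<^bsub>A\<^esub>),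
     ring.add = (\<lambda>f f' x. f x \<oplus>\<^bsub>A\<^esub> f' x)\<rparr>"

text \<open>\<open>A\<close> as a module over its skew group ring: \<open>(\<Sum> a\<^sub>g g) \<cdot> p = \<Sum> a\<^sub>g (\<alpha> g p)\<close>.\<close>

definition skew_group_module ::
    "('a, 'm) ring_scheme \<Rightarrow> ('g \<Rightarrow> 'a \<Rightarrow> 'a) \<Rightarrow> ('g \<Rightarrow> 'a, 'a) module"
  where "skew_group_module A \<alpha> =
    \<lparr>carrier = carrier A, monoid.mult = monoid.mult A, monoid.one = \<one>\<^bsub>A\<^esub>, ring.zero = \<zero>\<^bsub>A\<^esub>,
     ring.add = ring.add A,
     smult = (\<lambda>f p. \<Oplus>\<^bsub>A\<^esub>g\<in>{g. f g \<noteq> \<zero>\<^bsub>A\<^esub>}. f g \<otimes>\<^bsub>A\<^esub> \<alpha> g p)\<rparr>"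


section \<open>Noetherian left modules\<close>

text \<open>The HOL-Algebra locale \<open>module\<close> requires a commutative ring of scalars; the axioms are
  repeated here over an arbitrary ring. Its locale \<open>submodule\<close> carries no such restriction.\<close>

locale left_module = R?: ring R + M?: abelian_group M
  for R :: "('a, 'm) ring_scheme" (structure) and M :: "('a, 'b, 'n) module_scheme" (structure) +
  assumes smult_closed:
      "\<lbrakk>a \<in> carrier R; x \<in> carrier M\<rbrakk> \<Longrightarrow> a \<odot>\<^bsub>M\<^esub> x \<in> carrier M"
    and smult_l_distr:
      "\<lbrakk>a \<in> carrier R; b \<in> carrier R; x \<in> carrier M\<rbrakk> \<Longrightarrow>
        (a \<oplus>\<^bsub>R\<^esub> b) \<odot>\<^bsub>M\<^esub> x = a \<odot>\<^bsub>M\<^esub> x \<oplus>\<^bsub>M\<^esub> b \<odot>\<^bsub>M\<^esub> x"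
    and smult_r_distr:
      "\<lbrakk>a \<in> carrier R; x \<in> carrier M; y \<in> carrier M\<rbrakk> \<Longrightarrow>
        a \<odot>\<^bsub>M\<^esub> (x \<oplus>\<^bsub>M\<^esub> y) = a \<odot>\<^bsub>M\<^esub> x \<oplus>\<^bsub>M\<^esub> a \<odot>\<^bsub>M\<^esub> y"
    and smult_assoc:
      "\<lbrakk>a \<in> carrier R; b \<in> carrier R; x \<in> carrier M\<rbrakk> \<Longrightarrow>
        (a \<otimes>\<^bsub>R\<^esub> b) \<odot>\<^bsub>M\<^esub> x = a \<odot>\<^bsub>M\<^esub> (b \<odot>\<^bsub>M\<^esub> x)"
    and smult_one:
      "x \<in> carrier M \<Longrightarrow> \<one>\<^bsub>R\<^esub> \<odot>\<^bsub>M\<^esub> x = x"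

definition submodule_generated ::
    "('a, 'm) ring_scheme \<Rightarrow> ('a, 'b, 'n) module_scheme \<Rightarrow> 'b set \<Rightarrow> 'b set"
  where "submodule_generated R M B = \<Inter>{N. submodule N R M \<and> B \<subseteq> N}"

locale noetherian_left_module = left_module +
  assumes finitely_generated:
    "submodule N R M \<Longrightarrow> \<exists>B\<subseteq>carrier M. finite B \<and> N = submodule_generated R M B"

end

theory Submission
  imports Defs "HOL-Library.Multiset_Order" "HOL-Library.Sublist"
begin

text \<open>
A submodule of \<open>k[S]\<close> over the skew group ring is the same thing as an ideal of \<open>k[S]\<close> that is
stable under \<open>G\<close> (\<open>submodule_SkewMod_iff\<close>). The proof compares such ideals with ideals of a
polynomial ring in variables \<open>x\<^sub>0, x\<^sub>1, \<dots>\<close> that are stable under strictly increasing substitutions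
of the indices, for which a leading term argument works.

Suppose that \<open>S\<close> is infinite. Transitivity on finite subsets does not provide enough freedom to
permute given points, but it does leave only finitely many orbits on \<open>n\<close>-tuples of distinct points:
each such tuple can be moved to one whose entries form a fixed \<open>n\<close>-element set. Ramsey's theorem
therefore yields a sequence \<open>t\<^sub>0, t\<^sub>1, \<dots>\<close> in \<open>S\<close> such that every strictly increasing reindexing of
finitely many terms is induced by an element of \<open>G\<close> (\<open>indiscernible_sequence\<close>). Every polynomial
involves finitely many variables, so some element of \<open>G\<close> moves it into \<open>k[t\<^sub>0, t\<^sub>1, \<dots>]\<close>. Hence a
\<open>G\<close>-stable ideal \<open>N\<close> is determined by its trace on \<open>k[x\<^sub>0, x\<^sub>1, \<dots>]\<close>, and this trace is stable under
shifts. If \<open>S\<close> is finite, the same scheme applies with \<open>t\<close> an enumeration of \<open>S\<close> and with the identity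
as the only shift; it then reduces to Hilbert's basis theorem (\<open>coordinate_sequence\<close> covers both
cases).

It remains to see that shift-stable ideals are finitely generated as such
(\<open>shift_ideal_finitely_generated\<close>). The multiset order on monomials is a well-order compatible with
products and with increasing substitutions. If a shift-stable ideal were not finitely generated,
one could choose successively elements \<open>p\<^sub>i\<close> outside the shift-stable ideal generated by
the previous ones, each with the smallest possible leading monomial \<open>m\<^sub>i\<close>. Higman's lemma
(\<open>almost_full_list_emb\<close>), applied to exponent vectors, gives a subsequence in which each leading
monomial divides, after a shift, all later ones. Since \<open>k\<close> is Noetherian, the leading
coefficient of some \<open>p\<^sub>n\<close> in the subsequence lies in the ideal generated by the earlier leading
coefficients. So the leading term of \<open>p\<^sub>n\<close> can be cancelled by an element generated by the earlier
polynomials, which contradicts the minimality of \<open>m\<^sub>n\<close>.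
\<close>

section \<open>Almost full relations and Higman's lemma\<close>

text \<open>A transitive relation is almost full precisely when it is a well-quasi-order.\<close>

definition almost_full :: "('a \<Rightarrow> 'a \<Rightarrow> bool) \<Rightarrow> bool"
  where "almost_full P \<longleftrightarrow> (\<forall>f :: nat \<Rightarrow> 'a. \<exists>i j. i < j \<and> P (f i) (f j))"

text \<open>Colour a pair \<open>i < j\<close> of indices by whether \<open>P (f i) (f j)\<close> holds. An infinite homogeneous set of the
negative colour would be a sequence without any related pair, so Ramsey's theorem gives one of
the positive colour.\<close>

lemma almost_full_monotone_subsequence:
  assumes af: "almost_full P"
  shows "\<exists>\<phi> :: nat \<Rightarrow> nat. strict_mono \<phi> \<and> (\<forall>i j. i < j \<longrightarrow> P (f (\<phi> i)) (f (\<phi> j)))"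
proof -
  define c where "c E = (if P (f (Min E)) (f (Max E)) then 1 else 0 :: nat)" for E :: "nat set"
  have "\<exists>Y t. Y \<subseteq> (UNIV :: nat set) \<and> infinite Y \<and> t < 2 \<and> (\<forall>E. E \<subseteq> Y \<and> finite E \<and> card E = 2 \<longrightarrow> c E = t)"
    by (rule Ramsey) (auto simp: c_def)
  then obtain Y t where Yt: "infinite Y \<and> (\<forall>E. E \<subseteq> Y \<and> finite E \<and> card E = 2 \<longrightarrow> c E = t)"
    by (elim exE conjE) (rule that, rule conjI)
  then have Y: "infinite Y" and t: "\<And>E. E \<subseteq> Y \<Longrightarrow> finite E \<Longrightarrow> card E = 2 \<Longrightarrow> c E = t"
    by simp_all
  define \<phi> where "\<phi> = enumerate Y"
  have mono: "strict_mono \<phi>" unfolding \<phi>_def using Y by (rule strict_mono_enumerate)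
  have \<phi>: "P (f (\<phi> i)) (f (\<phi> j)) \<longleftrightarrow> t = 1" if "i < j" for i j
  proof -
    have lt: "\<phi> i < \<phi> j" using mono that by (rule strict_monoD)
    have "\<phi> i \<in> Y" "\<phi> j \<in> Y" using Y by (auto simp: \<phi>_def enumerate_in_set)
    then have "c {\<phi> i, \<phi> j} = t" using lt by (intro t) auto
    moreover have "Min {\<phi> i, \<phi> j} = \<phi> i" "Max {\<phi> i, \<phi> j} = \<phi> j" using lt by auto
    ultimately show ?thesis by (auto simp: c_def split: if_splits)
  qed
  obtain i j where "i < j" "P (f (\<phi> i)) (f (\<phi> j))"
    using af unfolding almost_full_def by (metis comp_apply[of f \<phi>])
  then have "t = 1" using \<phi> by simp
  then have "strict_mono \<phi> \<and> (\<forall>i j. i < j \<longrightarrow> P (f (\<phi> i)) (f (\<phi> j)))"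
    using mono \<phi> by simp
  then show ?thesis by (rule exI[of _ \<phi>])
qed

text \<open>The construction in Nash-Williams' minimal bad sequence argument. The \<open>n\<close>-th step replaces the
current bad sequence by one that agrees with it below \<open>n\<close> and whose \<open>n\<close>-th entry has the smallest
possible measure \<open>m\<close>; the entries stabilise. The premise on \<open>bad\<close> says that badness is a closed condition, which
makes the limit bad.\<close>

lemma minimal_sequence:
  fixes m :: "'a \<Rightarrow> nat" and bad :: "(nat \<Rightarrow> 'a) \<Rightarrow> bool"
  assumes "bad f" and agree: "\<And>g. (\<And>n. \<exists>h. bad h \<and> (\<forall>i<n. h i = g i)) \<Longrightarrow> bad g"
  shows "\<exists>g. bad g \<and> (\<forall>h n. bad h \<and> (\<forall>i<n. h i = g i) \<longrightarrow> m (g n) \<le> m (h n))"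
proof -
  define ok where "ok n g h \<longleftrightarrow> bad h \<and> (\<forall>i<n. h i = g i)" for n g h
  define nxt where "nxt n g = (ARG_MIN (\<lambda>h. m (h n)) h. ok n g h)" for n g
  define s where "s = rec_nat f nxt"
  have s_Suc: "s (Suc n) = nxt n (s n)" for n by (simp add: s_def)
  have bad_s: "bad (s n)" for n
  proof (induction n)
    case (Suc n)
    then have "ok n (s n) (s n)" by (simp add: ok_def)
    then have "ok n (s n) (nxt n (s n))" unfolding nxt_def by (rule arg_min_natI[where P = "ok n (s n)"])
    then show ?case by (simp add: s_Suc ok_def)
  qed (simp add: s_def assms)
  have step: "ok n (s n) (s (Suc n))" for n
    unfolding s_Suc nxt_def by (rule arg_min_natI[where P = "ok n (s n)" and k = "s n"]) (simp add: ok_def bad_s)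
  have stable: "s (n + d) i = s n i" if "i < n" for n d i
    using that step by (induction d) (auto simp: ok_def)
  \<comment> \<open>Entry n is fixed from stage Suc n on, so the limit is read off on the diagonal.\<close>
  define g where "g n = s (Suc n) n" for n
  have g_eq: "s n i = g i" if "i < n" for n i
  proof -
    from that obtain d where "n = Suc i + d" using less_imp_Suc_add by (metis add_Suc)
    then show ?thesis using stable[of i "Suc i" d] by (simp add: g_def)
  qed
  show ?thesis
  proof (intro exI[of _ g] conjI allI impI)
    show "bad g" by (rule agree) (use bad_s g_eq in blast)
    show "m (g n) \<le> m (h n)" if "bad h \<and> (\<forall>i<n. h i = g i)" for h n
    proof -
      have "ok n (s n) h" using that g_eq by (simp add: ok_def)
      then show ?thesis unfolding g_def s_Suc nxt_def
        by (rule arg_min_nat_le[where m = "\<lambda>h. m (h n)"])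
    qed
  qed
qed

text \<open>Higman's lemma. In a minimal bad sequence all lists are nonempty. Pass to a subsequence whose
heads are increasing and replace its members by their tails, keeping the part of the original sequence
that precedes it. The result is still bad, since an embedding of tails extends to the lists themselves,
but it contradicts minimality at the first replaced position.\<close>

theorem almost_full_list_emb:
  assumes af: "almost_full P"
  shows "almost_full (list_emb P)"
proof (rule ccontr)
  define bad where "bad f \<longleftrightarrow> (\<forall>i j. i < j \<longrightarrow> \<not> list_emb P (f i) (f j))" for f :: "nat \<Rightarrow> 'a list"
  assume "\<not> almost_full (list_emb P)"
  then obtain f where f: "bad f" by (auto simp: almost_full_def bad_def)
  have agree: "bad g" if "\<And>n. \<exists>h. bad h \<and> (\<forall>i<n. h i = g i)" for g
    unfolding bad_def
  proof (intro allI impI)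
    fix i j :: nat assume "i < j"
    obtain h where "bad h" "\<forall>i<Suc j. h i = g i" using \<open>\<And>n. \<exists>h. bad h \<and> (\<forall>i<n. h i = g i)\<close> by blast
    then show "\<not> list_emb P (g i) (g j)"
      using \<open>i < j\<close> unfolding bad_def by (metis less_Suc_eq)
  qed
  have "\<exists>g. bad g \<and> (\<forall>h n. bad h \<and> (\<forall>i<n. h i = g i) \<longrightarrow> length (g n) \<le> length (h n))"
    using f by (rule minimal_sequence) (rule agree)
  then obtain g where g: "bad g \<and> (\<forall>h n. bad h \<and> (\<forall>i<n. h i = g i) \<longrightarrow> length (g n) \<le> length (h n))"
    by (elim exE) (rule that)
  then have bad: "bad g"
    and minimal: "\<And>h n. bad h \<Longrightarrow> (\<And>i. i < n \<Longrightarrow> h i = g i) \<Longrightarrow> length (g n) \<le> length (h n)"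
    by simp_all
  have ne: "g n \<noteq> []" for n
  proof
    assume "g n = []"
    then have "list_emb P (g n) (g (Suc n))" by simp
    then show False using bad unfolding bad_def by blast
  qed
  have "\<exists>\<phi> :: nat \<Rightarrow> nat. strict_mono \<phi> \<and> (\<forall>i j. i < j \<longrightarrow> P (hd (g (\<phi> i))) (hd (g (\<phi> j))))"
    using af by (rule almost_full_monotone_subsequence[where f = "\<lambda>n. hd (g n)"])
  then obtain \<phi> :: "nat \<Rightarrow> nat" where \<phi>: "strict_mono \<phi> \<and> (\<forall>i j. i < j \<longrightarrow> P (hd (g (\<phi> i))) (hd (g (\<phi> j))))"
    by (elim exE) (rule that)
  then have mono: "strict_mono \<phi>" and hd: "\<And>i j. i < j \<Longrightarrow> P (hd (g (\<phi> i))) (hd (g (\<phi> j)))"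
    by simp_all
  define h where "h i = (if i < \<phi> 0 then g i else tl (g (\<phi> (i - \<phi> 0))))" for i
  have "bad h"
    unfolding bad_def
  proof (intro allI impI notI)
    fix i j :: nat
    assume ij: "i < j" and emb: "list_emb P (h i) (h j)"
    consider "j < \<phi> 0" | "i < \<phi> 0" "\<phi> 0 \<le> j" | "\<phi> 0 \<le> i" using ij by linarith
    then show False
    proof cases
      case 1
      then show ?thesis using ij emb bad by (auto simp: h_def bad_def)
    next
      case 2
      then have "list_emb P (g i) (tl (g (\<phi> (j - \<phi> 0))))" using emb by (simp add: h_def)
      then have "list_emb P (g i) (g (\<phi> (j - \<phi> 0)))"
        by (metis list.collapse list_emb_Cons ne)
      moreover have "i < \<phi> (j - \<phi> 0)"
        using 2 mono by (metis le0 less_le_trans strict_mono_less_eq)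
      ultimately show ?thesis using bad unfolding bad_def by blast
    next
      case 3
      define a b where "a = i - \<phi> 0" and "b = j - \<phi> 0"
      have ab: "a < b" using 3 ij by (auto simp: a_def b_def)
      have "list_emb P (tl (g (\<phi> a))) (tl (g (\<phi> b)))"
        using emb 3 ij by (simp add: h_def a_def b_def)
      then have "list_emb P (hd (g (\<phi> a)) # tl (g (\<phi> a))) (hd (g (\<phi> b)) # tl (g (\<phi> b)))"
        using hd[OF ab] by (rule list_emb_Cons2[rotated])
      then have "list_emb P (g (\<phi> a)) (g (\<phi> b))" by (simp add: ne)
      moreover have "\<phi> a < \<phi> b" using mono ab by (rule strict_monoD)
      ultimately show ?thesis using bad unfolding bad_def by blast
    qed
  qed
  then have "length (g (\<phi> 0)) \<le> length (h (\<phi> 0))"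
    by (rule minimal) (simp add: h_def)
  then show False using ne[of "\<phi> 0"] by (simp add: h_def) (metis diff_Suc_less leD length_greater_0_conv One_nat_def)
qed

lemma almost_full_le: "almost_full ((\<le>) :: nat \<Rightarrow> nat \<Rightarrow> bool)"
  unfolding almost_full_def
proof
  fix f :: "nat \<Rightarrow> nat"
  define n where "n = (ARG_MIN f n. True)"
  have "f n \<le> f (Suc n)" unfolding n_def by (rule arg_min_nat_le) simp
  then show "\<exists>i j. i < j \<and> f i \<le> f j" by blast
qed

text \<open>Embeddings of words are used below as increasing maps between positions.\<close>

lemma list_emb_index_map:
  assumes "list_emb P xs ys"
  shows "\<exists>f :: nat \<Rightarrow> nat. strict_mono_on {..<length xs} f \<and>
    (\<forall>i<length xs. f i < length ys \<and> P (xs ! i) (ys ! f i))"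
  using assms
proof (induction rule: list_emb.induct)
  case (list_emb_Nil ys)
  then show ?case by (simp add: strict_mono_on_def)
next
  case (list_emb_Cons xs ys y)
  then obtain f where f: "strict_mono_on {..<length xs} f"
    "\<forall>i<length xs. f i < length ys \<and> P (xs ! i) (ys ! f i)" by blast
  show ?case
  proof (intro exI conjI)
    show "strict_mono_on {..<length xs} (\<lambda>i. Suc (f i))"
      using f(1) by (simp add: strict_mono_on_def)
  qed (use f(2) in simp)
next
  case (list_emb_Cons2 x y xs ys)
  then obtain f where f: "strict_mono_on {..<length xs} f"
    "\<forall>i<length xs. f i < length ys \<and> P (xs ! i) (ys ! f i)" by blast
  show ?case
  proof (intro exI conjI)
    show "strict_mono_on {..<length (x # xs)} (case_nat 0 (\<lambda>i. Suc (f i)))"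
      using f(1) by (auto simp: strict_mono_on_def split: nat.split)
    show "\<forall>i<length (x # xs). case_nat 0 (\<lambda>i. Suc (f i)) i < length (y # ys) \<and>
        P ((x # xs) ! i) ((y # ys) ! case_nat 0 (\<lambda>i. Suc (f i)) i)"
      using f(2) list_emb_Cons2.hyps(1) by (auto split: nat.split)
  qed
qed

section \<open>Polynomial rings and renaming of variables\<close>

lemma finite_submultisets: "finite {n. n \<subseteq># m}"
proof (induction m)
  case empty
  then show ?case by simp
next
  case (add x m)
  have "{n. n \<subseteq># add_mset x m} \<subseteq> {n. n \<subseteq># m} \<union> add_mset x ` {n. n \<subseteq># m}"
  proof
    fix n assume n: "n \<in> {n. n \<subseteq># add_mset x m}"
    show "n \<in> {n. n \<subseteq># m} \<union> add_mset x ` {n. n \<subseteq># m}"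
    proof (cases "x \<in># n")
      case True
      then obtain n' where "n = add_mset x n'" by (meson multi_member_split)
      then show ?thesis using n by auto
    next
      case False
      then have "count n a \<le> count m a" for a
        using n by (cases "a = x") (auto simp: subseteq_mset_def not_in_iff split: if_splits dest!: spec[of _ a])
      then have "n \<subseteq># m" by (simp add: subseteq_mset_def)
      then show ?thesis by simp
    qed
  qed
  then show ?case using add.IH finite_subset by blast
qed

lemma inj_on_image_mset:
  assumes "inj_on f S"
  shows "inj_on (image_mset f) {m. set_mset m \<subseteq> S}"
proof (rule inj_on_inverseI)
  fix m assume "m \<in> {m. set_mset m \<subseteq> S}"
  then have "image_mset (inv_into S f \<circ> f) m = image_mset (\<lambda>x. x) m"
    using assms by (intro image_mset_cong) (auto simp: subset_iff)
  then show "image_mset (inv_into S f) (image_mset f m) = m"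
    by (simp add: image_mset.compositionality)
qed

context abelian_monoid
begin

text \<open>Together with \<open>finsum_swap\<close>, this is what the associativity proofs for the two kinds of convolution
products (polynomials and skew group rings) rest on.\<close>

lemma finsum_Sigma:
  assumes "finite A" "\<And>x. x \<in> A \<Longrightarrow> finite (B x)"
    and "\<And>x y. x \<in> A \<Longrightarrow> y \<in> B x \<Longrightarrow> f x y \<in> carrier G"
  shows "(\<Oplus>x\<in>A. \<Oplus>y\<in>B x. f x y) = finsum G (\<lambda>(x, y). f x y) (Sigma A B)"
  using assms
proof (induction A rule: finite_induct)
  case empty
  then show ?case by simp
next
  case (insert a F)
  have inner: "finsum G (\<lambda>(x, y). f x y) (Pair a ` B a) = (\<Oplus>y\<in>B a. f a y)"
    using insert.prems by (subst finsum_reindex) (auto simp: inj_on_def)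
  have split: "Sigma (insert a F) B = Pair a ` B a \<union> Sigma F B" by auto
  have "finsum G (\<lambda>(x, y). f x y) (Sigma (insert a F) B)
      = finsum G (\<lambda>(x, y). f x y) (Pair a ` B a) \<oplus> finsum G (\<lambda>(x, y). f x y) (Sigma F B)"
    unfolding split using insert.prems insert.hyps
    by (intro finsum_Un_disjoint) (auto intro!: finite_SigmaI)
  also have "\<dots> = (\<Oplus>y\<in>B a. f a y) \<oplus> (\<Oplus>x\<in>F. \<Oplus>y\<in>B x. f x y)"
    using insert.prems insert.IH by (simp add: inner)
  also have "\<dots> = (\<Oplus>x\<in>insert a F. \<Oplus>y\<in>B x. f x y)"
    using insert.prems insert.hyps by (subst finsum_insert) (auto intro!: finsum_closed)
  finally show ?case ..
qed

lemma finsum_swap: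
  assumes "finite A" "finite B" "\<And>x y. x \<in> A \<Longrightarrow> y \<in> B \<Longrightarrow> f x y \<in> carrier G"
  shows "(\<Oplus>x\<in>A. \<Oplus>y\<in>B. f x y) = (\<Oplus>y\<in>B. \<Oplus>x\<in>A. f x y)"
proof -
  have "(\<Oplus>x\<in>A. \<Oplus>y\<in>B. f x y) = finsum G (\<lambda>(x, y). f x y) (prod.swap ` (B \<times> A))"
    using assms by (simp add: finsum_Sigma product_swap)
  also have "\<dots> = finsum G (\<lambda>(y, x). f x y) (B \<times> A)"
    using assms by (subst finsum_reindex) (auto simp: case_prod_unfold)
  also have "\<dots> = (\<Oplus>y\<in>B. \<Oplus>x\<in>A. f x y)"
    using assms by (simp add: finsum_Sigma)
  finally show ?thesis .
qed

end

context ring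
begin

lemma indexed_poly_ring_simps [simp]:
  "carrier (indexed_poly_ring S) = indexed_pset S (carrier R)"
  "p \<otimes>\<^bsub>indexed_poly_ring S\<^esub> q = indexed_mult p q"
  "\<one>\<^bsub>indexed_poly_ring S\<^esub> = indexed_const \<one>"
  "\<zero>\<^bsub>indexed_poly_ring S\<^esub> = indexed_const \<zero>"
  "p \<oplus>\<^bsub>indexed_poly_ring S\<^esub> q = indexed_padd p q"
  by (simp_all add: indexed_poly_ring_def)

definition indexed_monom :: "'a \<Rightarrow> 'c multiset \<Rightarrow> 'c multiset \<Rightarrow> 'a"
  where "indexed_monom c m = (\<lambda>n. if n = m then c else \<zero>)"

lemma indexed_monom_closed:
  assumes "c \<in> carrier R" "set_mset m \<subseteq> S"
  shows "indexed_monom c m \<in> indexed_pset S (carrier R)"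
  using assms(2)
proof (induction m)
  case empty
  have "indexed_monom c {#} = indexed_const c"
    by (simp add: indexed_monom_def indexed_const_def fun_eq_iff)
  then show ?case using assms(1) by (metis indexed_pset.indexed_const)
next
  case (add x m)
  have "indexed_monom c (add_mset x m) = indexed_pmult (indexed_monom c m) x"
    by (auto simp: indexed_monom_def indexed_pmult_def fun_eq_iff dest: multi_member_split)
  then show ?case using add by (simp add: indexed_pset.indexed_pmult)
qed

text \<open>The inductively defined carrier consists of the finitely supported functions: for the converse
inclusion, monomials are built by multiplying with one variable at a time, and a polynomial
is the sum of its terms.\<close>

lemma indexed_pset_iff:
  "p \<in> indexed_pset S (carrier R) \<longleftrightarrow>
    range p \<subseteq> carrier R \<and> finite {m. p m \<noteq> \<zero>} \<and> (\<forall>m. p m \<noteq> \<zero> \<longrightarrow> set_mset m \<subseteq> S)"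
  (is "_ \<longleftrightarrow> ?P p")
proof
  assume "p \<in> indexed_pset S (carrier R)"
  then show "?P p"
  proof induction
    case (indexed_const c)
    then show ?case by (auto simp: indexed_const_def)
  next
    case (indexed_padd p q)
    have "{m. indexed_padd p q m \<noteq> \<zero>} \<subseteq> {m. p m \<noteq> \<zero>} \<union> {m. q m \<noteq> \<zero>}"
      by (auto simp: indexed_padd_def)
    then have "finite {m. indexed_padd p q m \<noteq> \<zero>}"
      using indexed_padd.IH by (meson finite_UnI finite_subset)
    moreover have "p m \<noteq> \<zero> \<or> q m \<noteq> \<zero>" if "indexed_padd p q m \<noteq> \<zero>" for m
      using that by (auto simp: indexed_padd_def)
    moreover have "indexed_padd p q m \<in> carrier R" for m
      using indexed_padd.IH by (auto simp: indexed_padd_def image_subset_iff)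
    ultimately show ?case using indexed_padd.IH by blast
  next
    case (indexed_pmult p i)
    have "{m. indexed_pmult p i m \<noteq> \<zero>} \<subseteq> add_mset i ` {m. p m \<noteq> \<zero>}"
      by (auto simp: indexed_pmult_def image_iff split: if_splits) (metis insert_DiffM)
    then have "finite {m. indexed_pmult p i m \<noteq> \<zero>}"
      using indexed_pmult.IH finite_subset by blast
    moreover have "set_mset m \<subseteq> S" if "indexed_pmult p i m \<noteq> \<zero>" for m
    proof -
      from that have i: "i \<in># m" and "p (m - {#i#}) \<noteq> \<zero>"
        by (auto simp: indexed_pmult_def split: if_splits)
      then have "set_mset (m - {#i#}) \<subseteq> S" using indexed_pmult.IH by blast
      moreover have "m = add_mset i (m - {#i#})" using i by simp
      ultimately show ?thesis using indexed_pmult.hyps(2)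
        by (metis insert_subset set_mset_add_mset_insert)
    qed
    ultimately show ?case using indexed_pmult.IH by (auto simp: indexed_pmult_def)
  qed
next
  assume P: "?P p"
  then show "p \<in> indexed_pset S (carrier R)"
  proof (induction "{m. p m \<noteq> \<zero>}" arbitrary: p rule: infinite_finite_induct)
    case infinite
    then show ?case by blast
  next
    case empty
    then have "p = indexed_const \<zero>" by (auto simp: indexed_const_def)
    then show ?case by (simp add: indexed_pset.indexed_const)
  next
    case (insert m F)
    define q where "q = (\<lambda>n. if n = m then \<zero> else p n)"
    have F: "F = {n. q n \<noteq> \<zero>}" using insert.hyps(2,4) by (auto simp: q_def)
    have "q \<in> indexed_pset S (carrier R)"
      using insert.prems insert.hyps(1) by (intro insert.hyps(3)[OF F]) (auto simp: F[symmetric], auto simp: q_def split: if_splits)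
    moreover have "indexed_monom (p m) m \<in> indexed_pset S (carrier R)"
      using insert.prems insert.hyps(4) by (intro indexed_monom_closed) auto
    moreover have "p = indexed_padd (indexed_monom (p m) m) q"
      using insert.prems by (auto simp: indexed_padd_def q_def indexed_monom_def fun_eq_iff image_subset_iff)
    ultimately show ?case by (metis indexed_pset.indexed_padd)
  qed
qed

lemma indexed_pset_coeff: "p \<in> indexed_pset S (carrier R) \<Longrightarrow> p m \<in> carrier R"
  by (auto simp: indexed_pset_iff)

lemma indexed_mult_closed:
  assumes "p \<in> indexed_pset S (carrier R)" "q \<in> indexed_pset S (carrier R)"
  shows "indexed_mult p q \<in> indexed_pset S (carrier R)"
proof -
  have support: "\<exists>a b. p a \<noteq> \<zero> \<and> q b \<noteq> \<zero> \<and> m = a + b" if "indexed_mult p q m \<noteq> \<zero>" for m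
  proof -
    have "\<exists>n. n \<subseteq># m \<and> p n \<otimes> q (m - n) \<noteq> \<zero>"
      using that unfolding indexed_mult_def by (metis (mono_tags, lifting) add.finprod_one_eqI mem_Collect_eq)
    then obtain n where "n \<subseteq># m" "p n \<noteq> \<zero>" "q (m - n) \<noteq> \<zero>"
      using assms by (metis indexed_pset_coeff l_null r_null)
    then show ?thesis by (metis subset_mset.add_diff_inverse)
  qed
  then have "{m. indexed_mult p q m \<noteq> \<zero>} \<subseteq> (\<lambda>(a, b). a + b) ` ({m. p m \<noteq> \<zero>} \<times> {m. q m \<noteq> \<zero>})"
    by fastforce
  then have "finite {m. indexed_mult p q m \<noteq> \<zero>}"
    using assms by (auto simp: indexed_pset_iff dest: finite_subset)
  moreover have "set_mset m \<subseteq> S" if "indexed_mult p q m \<noteq> \<zero>" for m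
  proof -
    obtain a b where "p a \<noteq> \<zero>" "q b \<noteq> \<zero>" "m = a + b" using support[OF \<open>indexed_mult p q m \<noteq> \<zero>\<close>] by blast
    then show ?thesis using assms by (simp add: indexed_pset_iff)
  qed
  moreover have "indexed_mult p q m \<in> carrier R" for m
    using assms by (auto simp: indexed_mult_def indexed_pset_coeff intro!: finsum_closed)
  ultimately show ?thesis by (auto simp: indexed_pset_iff)
qed

text \<open>Both sides are sums over the decompositions of \<open>m\<close> into three factors. One side lists them as
pairs \<open>(n, a)\<close> with \<open>a\<close> dividing \<open>n\<close> dividing \<open>m\<close>, the other one as pairs \<open>(a, b)\<close> of the first two
factors; \<open>(a, b) \<mapsto> (a + b, a)\<close> translates.\<close>

lemma indexed_mult_assoc:
  fixes p q r :: "'c multiset \<Rightarrow> 'a"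
  assumes "p \<in> indexed_pset S (carrier R)" "q \<in> indexed_pset S (carrier R)"
    "r \<in> indexed_pset S (carrier R)"
  shows "indexed_mult (indexed_mult p q) r = indexed_mult p (indexed_mult q r)"
proof
  fix m :: "'c multiset"
  note [simp] = assms[THEN indexed_pset_coeff] finite_submultisets
  let ?D = "\<lambda>m. {n. n \<subseteq># m}"
  let ?h = "\<lambda>(a, b). (a + b, a)"
  have image: "?h ` Sigma (?D m) (\<lambda>a. ?D (m - a)) = Sigma (?D m) ?D"
  proof (intro equalityI subsetI)
    fix x assume "x \<in> ?h ` Sigma (?D m) (\<lambda>a. ?D (m - a))"
    then show "x \<in> Sigma (?D m) ?D"
      by (auto simp: subset_mset.le_diff_conv2 add.commute)
  next
    fix x assume "x \<in> Sigma (?D m) ?D"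
    then obtain n a where x: "x = (n, a)" "n \<subseteq># m" "a \<subseteq># n" by auto
    then have "a \<subseteq># m" "n - a \<subseteq># m - a" "x = ?h (a, n - a)"
      by (auto simp: subseteq_mset_def multiset_eq_iff diff_le_mono intro: order_trans)
    then show "x \<in> ?h ` Sigma (?D m) (\<lambda>a. ?D (m - a))" by blast
  qed
  have inj: "inj_on ?h T" for T :: "('c multiset \<times> 'c multiset) set"
    by (auto simp: inj_on_def)
  have "indexed_mult (indexed_mult p q) r m
      = (\<Oplus>n\<in>?D m. \<Oplus>a\<in>?D n. p a \<otimes> q (n - a) \<otimes> r (m - n))"
    unfolding indexed_mult_def by (intro finsum_cong) (auto simp: finsum_ldistr simp_implies_def intro!: finsum_closed)
  also have "\<dots> = finsum R (\<lambda>(n, a). p a \<otimes> q (n - a) \<otimes> r (m - n)) (?h ` Sigma (?D m) (\<lambda>a. ?D (m - a)))"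
    unfolding image by (intro finsum_Sigma) auto
  also have "\<dots> = finsum R (\<lambda>(a, b). p a \<otimes> (q b \<otimes> r (m - a - b))) (Sigma (?D m) (\<lambda>a. ?D (m - a)))"
    by (subst finsum_reindex[OF _ inj]) (auto simp: case_prod_unfold m_assoc diff_diff_add)
  also have "\<dots> = (\<Oplus>a\<in>?D m. \<Oplus>b\<in>?D (m - a). p a \<otimes> (q b \<otimes> r (m - a - b)))"
    by (intro finsum_Sigma[symmetric]) auto
  also have "\<dots> = indexed_mult p (indexed_mult q r) m"
    unfolding indexed_mult_def by (intro finsum_cong) (auto simp: finsum_rdistr simp_implies_def intro!: finsum_closed)
  finally show "indexed_mult (indexed_mult p q) r m = indexed_mult p (indexed_mult q r) m" .
qed

lemma indexed_mult_monom:
  assumes "c \<in> carrier R" "p \<in> indexed_pset S (carrier R)"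
  shows "indexed_mult (indexed_monom c a) p = (\<lambda>m. if a \<subseteq># m then c \<otimes> p (m - a) else \<zero>)"
proof
  fix m
  note [simp] = assms(1) assms(2)[THEN indexed_pset_coeff] finite_submultisets
  have "indexed_mult (indexed_monom c a) p m
      = (\<Oplus>n\<in>{n. n \<subseteq># m}. if a = n then c \<otimes> p (m - n) else \<zero>)"
    unfolding indexed_mult_def indexed_monom_def by (intro finsum_cong) (auto simp: simp_implies_def)
  also have "\<dots> = (if a \<subseteq># m then c \<otimes> p (m - a) else \<zero>)"
    using finsum_singleton[of a "{n. n \<subseteq># m}" "\<lambda>n. c \<otimes> p (m - n)"]
    by (auto intro!: add.finprod_one_eqI)
  finally show "indexed_mult (indexed_monom c a) p m = (if a \<subseteq># m then c \<otimes> p (m - a) else \<zero>)" .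
qed

end

lemma (in cring) indexed_mult_comm:
  fixes p q :: "'c multiset \<Rightarrow> 'a"
  assumes "p \<in> indexed_pset S (carrier R)" "q \<in> indexed_pset S (carrier R)"
  shows "indexed_mult p q = indexed_mult q p"
proof
  fix m :: "'c multiset"
  note [simp] = assms[THEN indexed_pset_coeff]
  have double_diff: "m - (m - n) = n" if "n \<subseteq># m" for n :: "'c multiset"
    using that by (simp add: multiset_eq_iff subseteq_mset_def)
  have image: "(\<lambda>n. m - n) ` {n. n \<subseteq># m} = {n. n \<subseteq># m}"
  proof (intro equalityI subsetI)
    fix n assume "n \<in> {n. n \<subseteq># m}"
    then show "n \<in> (\<lambda>n. m - n) ` {n. n \<subseteq># m}"
      using double_diff[of n] by (intro image_eqI[of _ _ "m - n"]) auto
  qed auto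
  have inj: "inj_on (\<lambda>n. m - n) {n. n \<subseteq># m}"
    by (rule inj_on_inverseI[of _ "\<lambda>n. m - n"]) (simp add: double_diff)
  have "indexed_mult p q m = (\<Oplus>n\<in>(\<lambda>n. m - n) ` {n. n \<subseteq># m}. p n \<otimes> q (m - n))"
    unfolding image indexed_mult_def ..
  also have "\<dots> = (\<Oplus>n\<in>{n. n \<subseteq># m}. p (m - n) \<otimes> q (m - (m - n)))"
    by (subst finsum_reindex[OF _ inj]) auto
  also have "\<dots> = indexed_mult q p m"
    unfolding indexed_mult_def
    by (intro finsum_cong) (auto simp: simp_implies_def double_diff m_comm)
  finally show "indexed_mult p q m = indexed_mult q p m" .
qed

lemma (in cring) indexed_poly_ring_cring: "cring (indexed_poly_ring (S :: 'c set))"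
proof (rule cringI)
  let ?P = "indexed_pset S (carrier R)"
  show "abelian_group (indexed_poly_ring S)"
  proof (rule abelian_groupI)
    fix p assume "p \<in> carrier (indexed_poly_ring S)"
    then have p: "p \<in> ?P" by simp
    have neg_eq_zero: "\<ominus> x = \<zero> \<longleftrightarrow> x = \<zero>" if "x \<in> carrier R" for x
      using that by (metis minus_minus minus_zero)
    have "(\<lambda>m. \<ominus> p m) \<in> ?P"
      using p by (auto simp: indexed_pset_iff neg_eq_zero[OF indexed_pset_coeff[OF p]])
    then show "\<exists>y\<in>carrier (indexed_poly_ring S). y \<oplus>\<^bsub>indexed_poly_ring S\<^esub> p = \<zero>\<^bsub>indexed_poly_ring S\<^esub>"
      using p by (intro bexI[of _ "\<lambda>m. \<ominus> p m"])
        (auto simp: indexed_padd_def indexed_const_def indexed_pset_coeff l_neg)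
  qed (auto simp: indexed_padd_def indexed_const_def indexed_pset_coeff fun_eq_iff
        indexed_pset.indexed_padd[unfolded indexed_padd_def] a_ac
        intro!: indexed_pset.indexed_const[of \<zero>, unfolded indexed_const_def, simplified])
  have one: "indexed_const \<one> = indexed_monom \<one> {#}"
    by (simp add: indexed_const_def indexed_monom_def)
  show "Group.comm_monoid (indexed_poly_ring S)"
  proof (rule Group.comm_monoidI)
    show "\<one>\<^bsub>indexed_poly_ring S\<^esub> \<otimes>\<^bsub>indexed_poly_ring S\<^esub> p = p"
      if "p \<in> carrier (indexed_poly_ring S)" for p
      using that by (auto simp: one indexed_mult_monom indexed_pset_coeff)
    show "x \<otimes>\<^bsub>indexed_poly_ring S\<^esub> y = y \<otimes>\<^bsub>indexed_poly_ring S\<^esub> x"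
      if "x \<in> carrier (indexed_poly_ring S)" "y \<in> carrier (indexed_poly_ring S)" for x y
      using that by (simp add: indexed_mult_comm)
  qed (auto simp: indexed_mult_closed indexed_mult_assoc intro: indexed_pset.indexed_const)
  fix p q r :: "'c multiset \<Rightarrow> 'a"
  assume pqr: "p \<in> carrier (indexed_poly_ring S)" "q \<in> carrier (indexed_poly_ring S)"
    "r \<in> carrier (indexed_poly_ring S)"
  then have [simp]: "p m \<in> carrier R" "q m \<in> carrier R" "r m \<in> carrier R" for m
    by (auto simp: indexed_pset_coeff)
  show "(p \<oplus>\<^bsub>indexed_poly_ring S\<^esub> q) \<otimes>\<^bsub>indexed_poly_ring S\<^esub> r
      = p \<otimes>\<^bsub>indexed_poly_ring S\<^esub> r \<oplus>\<^bsub>indexed_poly_ring S\<^esub> q \<otimes>\<^bsub>indexed_poly_ring S\<^esub> r"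
    by (simp add: indexed_padd_def indexed_mult_def l_distr fun_eq_iff finsum_addf)
qed

context ring
begin

text \<open>For a renaming that is injective on the variables in use, no terms are merged, so renaming is just
transport of coefficients. Only such renamings occur below: permutations of \<open>S\<close>, shifts, and the
embedding of the variables \<open>x\<^sub>0, x\<^sub>1, \<dots>\<close> into \<open>S\<close> together with its inverse.\<close>

lemma indexed_rename_image:
  assumes p: "p \<in> indexed_pset S (carrier R)" and inj: "inj_on \<pi> S" and n: "set_mset n \<subseteq> S"
  shows "indexed_rename \<pi> p (image_mset \<pi> n) = p n"
proof -
  have "n' = n" if "p n' \<noteq> \<zero>" "image_mset \<pi> n' = image_mset \<pi> n" for n'
    using that p n by (intro inj_on_image_mset[OF inj, THEN inj_onD]) (auto simp: indexed_pset_iff)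
  then have "{n'. p n' \<noteq> \<zero> \<and> image_mset \<pi> n' = image_mset \<pi> n} = (if p n = \<zero> then {} else {n})"
    by auto
  then show ?thesis
    using indexed_pset_coeff[OF p] by (simp add: indexed_rename_def)
qed

lemma indexed_rename_support:
  assumes "indexed_rename \<pi> p m \<noteq> \<zero>"
  obtains n where "p n \<noteq> \<zero>" "m = image_mset \<pi> n"
  using assms unfolding indexed_rename_def
  by (metis (mono_tags, lifting) add.finprod_one_eqI mem_Collect_eq)

text \<open>The working characterisation of injective renaming: compare coefficients on renamed monomials and
check that nothing else occurs.\<close>

lemma indexed_rename_eqI:
  assumes p: "p \<in> indexed_pset S (carrier R)" and inj: "inj_on \<pi> S"
    and image: "\<And>n. set_mset n \<subseteq> S \<Longrightarrow> q (image_mset \<pi> n) = p n"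
    and support: "\<And>m. q m \<noteq> \<zero> \<Longrightarrow> \<exists>n. set_mset n \<subseteq> S \<and> m = image_mset \<pi> n"
  shows "indexed_rename \<pi> p = q"
proof
  fix m
  show "indexed_rename \<pi> p m = q m"
  proof (cases "\<exists>n. set_mset n \<subseteq> S \<and> m = image_mset \<pi> n")
    case True
    then show ?thesis using indexed_rename_image[OF p inj] image by auto
  next
    case False
    then have "q m = \<zero>" using support by blast
    moreover have "indexed_rename \<pi> p m = \<zero>"
      using False p by (metis indexed_rename_support indexed_pset_iff)
    ultimately show ?thesis by simp
  qed
qed

lemma indexed_rename_closed:
  assumes p: "p \<in> indexed_pset S (carrier R)" and inj: "inj_on \<pi> S" and sub: "\<pi> ` S \<subseteq> S'"
  shows "indexed_rename \<pi> p \<in> indexed_pset S' (carrier R)"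
proof -
  have "{m. indexed_rename \<pi> p m \<noteq> \<zero>} \<subseteq> image_mset \<pi> ` {n. p n \<noteq> \<zero>}"
    by (auto elim!: indexed_rename_support)
  then have "finite {m. indexed_rename \<pi> p m \<noteq> \<zero>}"
    using p finite_subset by (fastforce simp: indexed_pset_iff)
  moreover have "set_mset m \<subseteq> S'" if "indexed_rename \<pi> p m \<noteq> \<zero>" for m
  proof -
    obtain n where "p n \<noteq> \<zero>" "m = image_mset \<pi> n" using \<open>indexed_rename \<pi> p m \<noteq> \<zero>\<close> by (rule indexed_rename_support)
    moreover from this have "set_mset n \<subseteq> S" using p by (simp add: indexed_pset_iff)
    ultimately show ?thesis using sub by auto
  qed
  moreover have "indexed_rename \<pi> p m \<in> carrier R" for m
    using indexed_pset_coeff[OF p] by (auto simp: indexed_rename_def intro!: finsum_closed)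
  ultimately show ?thesis by (auto simp: indexed_pset_iff)
qed

lemma indexed_rename_padd:
  assumes "p \<in> indexed_pset S (carrier R)" "q \<in> indexed_pset S (carrier R)" "inj_on \<pi> S"
  shows "indexed_rename \<pi> (indexed_padd p q) = indexed_padd (indexed_rename \<pi> p) (indexed_rename \<pi> q)"
proof (rule indexed_rename_eqI)
  show "indexed_padd p q \<in> indexed_pset S (carrier R)"
    using assms by (simp add: indexed_pset.indexed_padd)
  show "indexed_padd (indexed_rename \<pi> p) (indexed_rename \<pi> q) (image_mset \<pi> n) = indexed_padd p q n"
    if "set_mset n \<subseteq> S" for n
    using assms that by (simp add: indexed_padd_def indexed_rename_image)
  show "\<exists>n. set_mset n \<subseteq> S \<and> m = image_mset \<pi> n"
    if "indexed_padd (indexed_rename \<pi> p) (indexed_rename \<pi> q) m \<noteq> \<zero>" for m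
  proof -
    have "indexed_rename \<pi> p m \<noteq> \<zero> \<or> indexed_rename \<pi> q m \<noteq> \<zero>"
      using that by (auto simp: indexed_padd_def)
    then show ?thesis
      using assms by (metis indexed_rename_support indexed_pset_iff)
  qed
qed (fact assms)

lemma indexed_rename_const:
  assumes "c \<in> carrier R"
  shows "indexed_rename \<pi> (indexed_const c) = indexed_const c"
proof (rule indexed_rename_eqI[of _ "{}"])
  show "indexed_const c \<in> indexed_pset {} (carrier R)"
    using assms by (rule indexed_pset.indexed_const)
qed (auto simp: indexed_const_def split: if_splits)

lemma indexed_rename_mult:
  fixes p q :: "'c multiset \<Rightarrow> 'a" and \<pi> :: "'c \<Rightarrow> 'd"
  assumes p: "p \<in> indexed_pset S (carrier R)" and q: "q \<in> indexed_pset S (carrier R)"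
    and inj: "inj_on \<pi> S"
  shows "indexed_rename \<pi> (indexed_mult p q) = indexed_mult (indexed_rename \<pi> p) (indexed_rename \<pi> q)"
proof (rule indexed_rename_eqI)
  show "indexed_mult p q \<in> indexed_pset S (carrier R)"
    using p q by (rule indexed_mult_closed)
  note [simp] = indexed_pset_coeff[OF p] indexed_pset_coeff[OF q]
    indexed_pset_coeff[OF indexed_rename_closed[OF p inj subset_refl]]
    indexed_pset_coeff[OF indexed_rename_closed[OF q inj subset_refl]]
  show "indexed_mult (indexed_rename \<pi> p) (indexed_rename \<pi> q) (image_mset \<pi> n) = indexed_mult p q n"
    if n: "set_mset n \<subseteq> S" for n
  proof -
    have sub: "set_mset a \<subseteq> S" if "a \<subseteq># n" for a
      using that n by (meson set_mset_mono subset_trans)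
    have inj': "inj_on (image_mset \<pi>) {a. a \<subseteq># n}"
      using sub by (intro inj_on_subset[OF inj_on_image_mset[OF inj]]) auto
    have image: "{b. b \<subseteq># image_mset \<pi> n} = image_mset \<pi> ` {a. a \<subseteq># n}"
    proof (intro equalityI subsetI)
      fix b assume "b \<in> {b. b \<subseteq># image_mset \<pi> n}"
      then obtain c where "image_mset \<pi> n = b + c" by (auto simp: subset_mset.le_iff_add)
      then obtain a d where "n = a + d" "b = image_mset \<pi> a" by (meson image_mset_eq_plusD)
      then show "b \<in> image_mset \<pi> ` {a. a \<subseteq># n}" by simp
    qed (auto simp: image_mset_subseteq_mono)
    have "indexed_mult (indexed_rename \<pi> p) (indexed_rename \<pi> q) (image_mset \<pi> n)
        = (\<Oplus>a\<in>{a. a \<subseteq># n}. indexed_rename \<pi> p (image_mset \<pi> a) \<otimes>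
            indexed_rename \<pi> q (image_mset \<pi> n - image_mset \<pi> a))"
      unfolding indexed_mult_def image by (subst finsum_reindex[OF _ inj']) auto
    also have "\<dots> = indexed_mult p q n"
      unfolding indexed_mult_def
    proof (rule finsum_cong'[OF refl])
      fix a assume "a \<in> {a. a \<subseteq># n}"
      then have a: "a \<subseteq># n" by simp
      have "set_mset (n - a) \<subseteq> S" by (rule sub) simp
      then show "indexed_rename \<pi> p (image_mset \<pi> a) \<otimes> indexed_rename \<pi> q (image_mset \<pi> n - image_mset \<pi> a)
          = p a \<otimes> q (n - a)"
        using sub[OF a] by (simp add: image_mset_Diff[OF a, symmetric] indexed_rename_image[OF p inj]
            indexed_rename_image[OF q inj])
    qed auto
    finally show ?thesis .
  qed
  show "\<exists>n. set_mset n \<subseteq> S \<and> m = image_mset \<pi> n"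
    if nz: "indexed_mult (indexed_rename \<pi> p) (indexed_rename \<pi> q) m \<noteq> \<zero>" for m
  proof -
    have "\<exists>b. b \<subseteq># m \<and> indexed_rename \<pi> p b \<otimes> indexed_rename \<pi> q (m - b) \<noteq> \<zero>"
      using nz unfolding indexed_mult_def by (metis (mono_tags, lifting) add.finprod_one_eqI mem_Collect_eq)
    then obtain b where b: "b \<subseteq># m" "indexed_rename \<pi> p b \<noteq> \<zero>" "indexed_rename \<pi> q (m - b) \<noteq> \<zero>"
      by (auto) (metis l_null r_null indexed_pset_coeff[OF indexed_rename_closed[OF p inj subset_refl]]
        indexed_pset_coeff[OF indexed_rename_closed[OF q inj subset_refl]])
    from b(2) obtain a where "p a \<noteq> \<zero>" "b = image_mset \<pi> a" by (rule indexed_rename_support)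
    moreover from b(3) obtain c where "q c \<noteq> \<zero>" "m - b = image_mset \<pi> c" by (rule indexed_rename_support)
    ultimately have "set_mset (a + c) \<subseteq> S \<and> m = image_mset \<pi> (a + c)"
      using p q b(1) by (auto simp: indexed_pset_iff) (metis subset_mset.add_diff_inverse)
    then show ?thesis by blast
  qed
qed (fact inj)

lemma indexed_rename_comp:
  assumes p: "p \<in> indexed_pset S (carrier R)" and inj: "inj_on \<pi> S" and sub: "\<pi> ` S \<subseteq> S'"
    and inj': "inj_on \<sigma> S'"
  shows "indexed_rename \<sigma> (indexed_rename \<pi> p) = indexed_rename (\<sigma> \<circ> \<pi>) p"
proof (rule indexed_rename_eqI)
  have q: "indexed_rename \<pi> p \<in> indexed_pset S' (carrier R)"
    using p inj sub by (rule indexed_rename_closed)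
  then show "indexed_rename \<pi> p \<in> indexed_pset S' (carrier R)" .
  have inj'': "inj_on (\<sigma> \<circ> \<pi>) S" using inj inj' sub by (meson comp_inj_on inj_on_subset)
  show "indexed_rename (\<sigma> \<circ> \<pi>) p (image_mset \<sigma> n) = indexed_rename \<pi> p n" if "set_mset n \<subseteq> S'" for n
  proof (cases "\<exists>a. set_mset a \<subseteq> S \<and> n = image_mset \<pi> a")
    case True
    then obtain a where a: "set_mset a \<subseteq> S" "n = image_mset \<pi> a" by blast
    then show ?thesis
      using indexed_rename_image[OF p inj a(1)] indexed_rename_image[OF p inj'' a(1)]
      by (simp add: image_mset.compositionality)
  next
    case False
    then have "indexed_rename \<pi> p n = \<zero>"
      using p by (metis indexed_rename_support indexed_pset_iff)
    moreover have "indexed_rename (\<sigma> \<circ> \<pi>) p (image_mset \<sigma> n) = \<zero>"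
    proof (rule ccontr)
      assume "indexed_rename (\<sigma> \<circ> \<pi>) p (image_mset \<sigma> n) \<noteq> \<zero>"
      then obtain a where a: "p a \<noteq> \<zero>" "image_mset \<sigma> n = image_mset (\<sigma> \<circ> \<pi>) a"
        by (rule indexed_rename_support)
      then have "set_mset a \<subseteq> S" using p by (simp add: indexed_pset_iff)
      moreover have "n = image_mset \<pi> a"
      proof (rule inj_on_image_mset[OF inj', THEN inj_onD])
      qed (use a that sub \<open>set_mset a \<subseteq> S\<close> in \<open>auto simp: image_mset.compositionality\<close>)
      ultimately show False using False by blast
    qed
    ultimately show ?thesis by simp
  qed
  show "\<exists>n. set_mset n \<subseteq> S' \<and> m = image_mset \<sigma> n" if "indexed_rename (\<sigma> \<circ> \<pi>) p m \<noteq> \<zero>" for m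
  proof -
    from that obtain a where a: "p a \<noteq> \<zero>" "m = image_mset (\<sigma> \<circ> \<pi>) a" by (rule indexed_rename_support)
    then have "set_mset a \<subseteq> S" using p by (simp add: indexed_pset_iff)
    then have "set_mset (image_mset \<pi> a) \<subseteq> S'" using sub by auto
    then show ?thesis using a(2) by (metis image_mset.compositionality)
  qed
qed (fact inj')

lemma indexed_rename_cong:
  assumes p: "p \<in> indexed_pset S (carrier R)" and "\<And>s. s \<in> S \<Longrightarrow> \<pi> s = \<sigma> s"
  shows "indexed_rename \<pi> p = indexed_rename \<sigma> p"
proof -
  have "image_mset \<pi> n = image_mset \<sigma> n" if "p n \<noteq> \<zero>" for n
    using that assms by (auto simp: indexed_pset_iff intro!: image_mset_cong)
  then have "{n. p n \<noteq> \<zero> \<and> image_mset \<pi> n = m} = {n. p n \<noteq> \<zero> \<and> image_mset \<sigma> n = m}" for m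
    by auto
  then show ?thesis by (simp add: indexed_rename_def)
qed

lemma indexed_rename_ident:
  assumes p: "p \<in> indexed_pset S (carrier R)" and "\<And>s. s \<in> S \<Longrightarrow> \<pi> s = s"
  shows "indexed_rename \<pi> p = p"
proof -
  have image: "image_mset \<pi> n = n" if "set_mset n \<subseteq> S" for n
  proof -
    have "image_mset \<pi> n = image_mset (\<lambda>s. s) n"
      using that assms(2) by (intro image_mset_cong) auto
    then show ?thesis by simp
  qed
  show ?thesis
  proof (rule indexed_rename_eqI[OF p])
    show "inj_on \<pi> S" using assms(2) by (simp add: inj_on_def)
    show "\<exists>n. set_mset n \<subseteq> S \<and> m = image_mset \<pi> n" if "p m \<noteq> \<zero>" for m
      using that p image by (metis indexed_pset_iff)
  qed (simp add: image)
qed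

end

lemma (in cring) indexed_rename_ring_hom:
  assumes "inj_on \<pi> S" "\<pi> ` S \<subseteq> S'"
  shows "indexed_rename \<pi> \<in> ring_hom (indexed_poly_ring S) (indexed_poly_ring S')"
  using assms by (intro ring_hom_memI)
    (auto simp: indexed_rename_closed indexed_rename_mult indexed_rename_padd indexed_rename_const)

section \<open>Ideals stable under shifts of the variables\<close>

lemma image_mset_subseteqI:
  assumes inj: "inj_on f A" and m: "set_mset m \<subseteq> A"
    and le: "\<And>x. x \<in> A \<Longrightarrow> count m x \<le> count m' (f x)"
  shows "image_mset f m \<subseteq># m'"
  unfolding subseteq_mset_def
proof
  fix y
  show "count (image_mset f m) y \<le> count m' y"
  proof (cases "y \<in> f ` set_mset m")
    case False
    then have "count (image_mset f m) y = 0" by (simp add: count_eq_zero_iff)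
    then show ?thesis by simp
  next
    case True
    then obtain x where x: "x \<in># m" "y = f x" by blast
    then have "f -` {y} \<inter> set_mset m = {x}" using inj m by (auto simp: inj_on_def subset_iff)
    then show ?thesis using x m le[of x] by (auto simp: count_image_mset)
  qed
qed

text \<open>The multiset order compares the largest variables first. Consequently a bound on the variables of
the leading monomial bounds all variables of a polynomial, and a shift that is defined on the leading
monomial is defined on the whole polynomial.\<close>

lemma multiset_le_imp_set_mset_bounded:
  fixes m n :: "nat multiset"
  assumes "n \<le> m" "set_mset m \<subseteq> {..<l}"
  shows "set_mset n \<subseteq> {..<l}"
proof (rule ccontr)
  assume "\<not> set_mset n \<subseteq> {..<l}"
  then obtain y where y: "y \<in># n" "l \<le> y" by (auto simp: subset_iff not_less)
  then have m: "count m y = 0" using assms(2) by (auto simp: count_eq_zero_iff subset_iff)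
  have "\<forall>y. count m y < count n y \<longrightarrow> (\<exists>x. y < x \<and> count n x < count m x)"
    using assms(1) unfolding less_eq_multiset\<^sub>H\<^sub>O .
  moreover have "count m y < count n y" using y(1) m by simp
  ultimately obtain x where "y < x" "count n x < count m x" by (elim allE[of _ y] impE exE conjE) 
  then have "0 < count m x" by linarith
  then have "x \<in># m" by simp
  then show False using assms(2) y(2) \<open>y < x\<close> by auto
qed

text \<open>Divisibility of monomials up to a shift. The set \<open>Ls\<close> contains the admissible numbers of variables:
with \<open>Ls = UNIV\<close> there are infinitely many variables and arbitrary increasing shifts between initial
segments, whereas \<open>Ls = {N}\<close> gives \<open>N\<close> variables and only the identity as shift.\<close>

definition shift_le :: "nat set \<Rightarrow> nat multiset \<Rightarrow> nat multiset \<Rightarrow> bool"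
  where "shift_le Ls m m' \<longleftrightarrow> (\<exists>l\<in>Ls. \<exists>l'\<in>Ls. \<exists>f. strict_mono_on {..<l} f \<and> f ` {..<l} \<subseteq> {..<l'} \<and>
    set_mset m \<subseteq> {..<l} \<and> set_mset m' \<subseteq> {..<l'} \<and> image_mset f m \<subseteq># m')"

lemma finite_subset_UN_lessThan:
  fixes Ls :: "nat set"
  assumes "finite M" "M \<subseteq> (\<Union>l\<in>Ls. {..<l})" "Ls \<noteq> {}"
  obtains l where "l \<in> Ls" "M \<subseteq> {..<l}"
proof (cases "M = {}")
  case True
  then show ?thesis using assms(3) that by blast
next
  case False
  then have "Max M \<in> (\<Union>l\<in>Ls. {..<l})" using assms by (meson Max_in subsetD)
  then obtain l where l: "l \<in> Ls" "Max M < l" by auto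
  have "M \<subseteq> {..<l}" using l(2) assms(1) by (auto intro: le_less_trans[OF Max_ge])
  then show ?thesis using l(1) that by simp
qed

text \<open>Encode each monomial by its list of exponents and apply Higman's lemma: an embedding of exponent
lists is exactly a shift followed by a divisibility. For \<open>Ls = {N}\<close> all lists have length \<open>N\<close>, and
the statement is Dickson's lemma.\<close>

lemma shift_le_subsequence:
  fixes Ls :: "nat set" and m :: "nat \<Rightarrow> nat multiset"
  assumes ne: "Ls \<noteq> {}" and m: "\<And>i. set_mset (m i) \<subseteq> (\<Union>l\<in>Ls. {..<l})"
  shows "\<exists>\<phi> :: nat \<Rightarrow> nat. strict_mono \<phi> \<and> (\<forall>i j. i < j \<longrightarrow> shift_le Ls (m (\<phi> i)) (m (\<phi> j)))"
proof -
  have "\<exists>l\<in>Ls. set_mset (m i) \<subseteq> {..<l}" for i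
    using finite_subset_UN_lessThan[OF finite_set_mset m ne] by metis
  then obtain l where l: "\<And>i. l i \<in> Ls" "\<And>i. set_mset (m i) \<subseteq> {..<l i}" by metis
  define w where "w i = map (count (m i)) [0..<l i]" for i
  have "\<exists>\<phi> :: nat \<Rightarrow> nat. strict_mono \<phi> \<and> (\<forall>i j. i < j \<longrightarrow> list_emb (\<le>) (w (\<phi> i)) (w (\<phi> j)))"
    by (rule almost_full_monotone_subsequence[OF almost_full_list_emb[OF almost_full_le]])
  then obtain \<phi> :: "nat \<Rightarrow> nat"
    where \<phi>: "strict_mono \<phi> \<and> (\<forall>i j. i < j \<longrightarrow> list_emb (\<le>) (w (\<phi> i)) (w (\<phi> j)))"
    by (elim exE) (rule that)
  have "shift_le Ls (m i) (m j)" if emb: "list_emb (\<le>) (w i) (w j)" for i j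
  proof -
    obtain f :: "nat \<Rightarrow> nat" where "strict_mono_on {..<length (w i)} f \<and>
      (\<forall>x<length (w i). f x < length (w j) \<and> w i ! x \<le> w j ! f x)"
      using list_emb_index_map[OF emb] by (elim exE) (rule that)
    then have f: "strict_mono_on {..<l i} f" "\<forall>x<l i. f x < l j \<and> count (m i) x \<le> count (m j) (f x)"
      by (auto simp: w_def)
    have "image_mset f (m i) \<subseteq># m j"
      using f l by (intro image_mset_subseteqI[of f "{..<l i}"] strict_mono_on_imp_inj_on) auto
    then show ?thesis using f l unfolding shift_le_def by blast
  qed
  then show ?thesis using \<phi> by blast
qed

context cring
begin

definition shift_ideal :: "nat set \<Rightarrow> (nat multiset \<Rightarrow> 'a) set \<Rightarrow> bool"
  where "shift_ideal Ls J \<longleftrightarrow> ideal J (indexed_poly_ring (\<Union>l\<in>Ls. {..<l})) \<and>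
    (\<forall>l\<in>Ls. \<forall>l'\<in>Ls. \<forall>f p. strict_mono_on {..<l} f \<and> f ` {..<l} \<subseteq> {..<l'} \<and>
      p \<in> J \<inter> indexed_pset {..<l} (carrier R) \<longrightarrow> indexed_rename f p \<in> J)"

text \<open>An upper bound for the leading monomial with respect to the multiset order. This avoids a separate
treatment of the zero polynomial.\<close>

definition monomials_le :: "(nat multiset \<Rightarrow> 'a) \<Rightarrow> nat multiset \<Rightarrow> bool"
  where "monomials_le p m \<longleftrightarrow> (\<forall>n. p n \<noteq> \<zero> \<longrightarrow> n \<le> m)"

lemma shift_idealD:
  assumes "shift_ideal Ls J"
  shows "J \<subseteq> indexed_pset (\<Union>l\<in>Ls. {..<l}) (carrier R)"
    and "(\<lambda>_. \<zero>) \<in> J"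
    and "p \<in> J \<Longrightarrow> q \<in> J \<Longrightarrow> indexed_padd p q \<in> J"
    and "a \<in> indexed_pset (\<Union>l\<in>Ls. {..<l}) (carrier R) \<Longrightarrow> p \<in> J \<Longrightarrow> indexed_mult a p \<in> J"
    and "l \<in> Ls \<Longrightarrow> l' \<in> Ls \<Longrightarrow> strict_mono_on {..<l} f \<Longrightarrow> f ` {..<l} \<subseteq> {..<l'} \<Longrightarrow> p \<in> J \<Longrightarrow>
      p \<in> indexed_pset {..<l} (carrier R) \<Longrightarrow> indexed_rename f p \<in> J"
proof -
  let ?A = "indexed_poly_ring (\<Union>l\<in>Ls. {..<l})"
  have J: "ideal J ?A" using assms by (simp add: shift_ideal_def)
  have add: "additive_subgroup J ?A" using J by (rule ideal.axioms(1))
  show "J \<subseteq> indexed_pset (\<Union>l\<in>Ls. {..<l}) (carrier R)"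
    using additive_subgroup.a_subset[OF add] by simp
  show "(\<lambda>_. \<zero>) \<in> J"
    using additive_subgroup.zero_closed[OF add] by (simp add: indexed_zero_def)
  show "indexed_padd p q \<in> J" if "p \<in> J" "q \<in> J"
    using additive_subgroup.a_closed[OF add that] by simp
  show "indexed_mult a p \<in> J" if "a \<in> indexed_pset (\<Union>l\<in>Ls. {..<l}) (carrier R)" "p \<in> J"
    using ideal.I_l_closed[OF J that(2), of a] that(1) by simp
  show "indexed_rename f p \<in> J"
    if "l \<in> Ls" "l' \<in> Ls" "strict_mono_on {..<l} f" "f ` {..<l} \<subseteq> {..<l'}" "p \<in> J"
      "p \<in> indexed_pset {..<l} (carrier R)"
    using assms that unfolding shift_ideal_def by blast
qed

lemma shift_ideal_Inter:
  assumes "\<And>J. J \<in> \<J> \<Longrightarrow> shift_ideal Ls J" "\<J> \<noteq> {}"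
  shows "shift_ideal Ls (\<Inter>\<J>)"
  unfolding shift_ideal_def
proof (intro conjI ballI allI impI)
  interpret A: cring "indexed_poly_ring (\<Union>l\<in>Ls. {..<l})" by (rule indexed_poly_ring_cring)
  show "ideal (\<Inter>\<J>) (indexed_poly_ring (\<Union>l\<in>Ls. {..<l}))"
    using assms by (intro A.i_Intersect) (auto simp: shift_ideal_def)
  fix l l' f p
  assume "l \<in> Ls" "l' \<in> Ls" and f: "strict_mono_on {..<l} f \<and> f ` {..<l} \<subseteq> {..<l'} \<and>
    p \<in> \<Inter>\<J> \<inter> indexed_pset {..<l} (carrier R)"
  then show "indexed_rename f p \<in> \<Inter>\<J>"
    using shift_idealD(5)[OF assms(1)] by blast
qed

lemma monomials_le_add:
  "monomials_le p m \<Longrightarrow> monomials_le q m \<Longrightarrow> monomials_le (indexed_padd p q) m"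
  by (auto simp: monomials_le_def indexed_padd_def) (metis l_zero zero_closed)

lemma indexed_mult_scalar:
  assumes "c \<in> carrier R" "p \<in> indexed_pset S (carrier R)"
  shows "indexed_mult (indexed_monom c {#}) p = (\<lambda>m. c \<otimes> p m)"
  using assms by (simp add: indexed_mult_monom)

lemma monomials_le_scalar:
  assumes "c \<in> carrier R" "monomials_le p m"
  shows "monomials_le (\<lambda>n. c \<otimes> p n) m"
  using assms unfolding monomials_le_def by (metis r_null)

lemma leading_coeff_ideal:
  assumes J: "shift_ideal Ls J"
  shows "ideal {q m |q. q \<in> J \<and> monomials_le q m} R" (is "ideal ?Q R")
proof (rule idealI)
  have pset: "q \<in> indexed_pset (\<Union>l\<in>Ls. {..<l}) (carrier R)" if "q \<in> J" for q
    using that shift_idealD(1)[OF J] by blast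
  have scalar: "c \<otimes> x \<in> ?Q" if c: "c \<in> carrier R" and "x \<in> ?Q" for c x
  proof -
    obtain q where q: "q \<in> J" "monomials_le q m" "x = q m" using \<open>x \<in> ?Q\<close> by blast
    have "(\<lambda>n. c \<otimes> q n) \<in> J"
      using shift_idealD(4)[OF J indexed_monom_closed[OF c, of "{#}"] q(1)] c pset[OF q(1)]
      by (simp add: indexed_mult_scalar)
    then show ?thesis
      using monomials_le_scalar[OF c q(2)] q(3) by (intro CollectI exI[of _ "\<lambda>n. c \<otimes> q n"]) simp
  qed
  have closed: "?Q \<subseteq> carrier R" using indexed_pset_coeff[OF pset] by auto
  show "ring R" by (rule ring_axioms)
  show "subgroup ?Q (add_monoid R)"
  proof (rule subgroup.intro)
    show "?Q \<subseteq> carrier (add_monoid R)" using closed by simp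
    show "\<one>\<^bsub>add_monoid R\<^esub> \<in> ?Q"
      using shift_idealD(2)[OF J] by (auto simp: monomials_le_def intro!: exI[of _ "\<lambda>_. \<zero>"])
    show "x \<otimes>\<^bsub>add_monoid R\<^esub> y \<in> ?Q" if xy: "x \<in> ?Q" "y \<in> ?Q" for x y
    proof -
      obtain p q where "p \<in> J" "monomials_le p m" "x = p m" "q \<in> J" "monomials_le q m" "y = q m"
        using xy by blast
      then show ?thesis
        using shift_idealD(3)[OF J] monomials_le_add
        by (auto simp: indexed_padd_def intro!: exI[of _ "indexed_padd p q"])
    qed
    show "inv\<^bsub>add_monoid R\<^esub> x \<in> ?Q" if "x \<in> ?Q" for x
    proof -
      have "x \<in> carrier R" using that closed by blast
      then have "\<ominus> \<one> \<otimes> x = inv\<^bsub>add_monoid R\<^esub> x" by (simp add: l_minus a_inv_def[symmetric])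
      then show ?thesis using scalar[OF _ that, of "\<ominus> \<one>"] by simp
    qed
  qed
  show "x \<otimes> a \<in> ?Q" if "a \<in> ?Q" "x \<in> carrier R" for a x using that by (intro scalar)
  show "a \<otimes> x \<in> ?Q" if "a \<in> ?Q" "x \<in> carrier R" for a x
  proof -
    have "a \<in> carrier R" using that(1) closed by (rule subsetD[rotated])
    then have "a \<otimes> x = x \<otimes> a" using that(2) by (rule m_comm)
    then show ?thesis using scalar[OF that(2,1)] by simp
  qed
qed

text \<open>Apply to \<open>p\<close> the shift that witnesses \<open>shift_le\<close> and multiply by the cofactor of the shifted leading
monomial. Increasing substitutions and multiplication by a monomial both preserve the multiset order,
so the leading term of \<open>p\<close> stays the leading term.\<close>

lemma leading_coeff_transfer:
  assumes J: "shift_ideal Ls J" and p: "p \<in> J" "monomials_le p m" and le: "shift_le Ls m m'"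
    and m': "set_mset m' \<subseteq> (\<Union>l\<in>Ls. {..<l})"
  shows "\<exists>q\<in>J. monomials_le q m' \<and> q m' = p m"
proof -
  obtain l l' f where l: "l \<in> Ls" "l' \<in> Ls" and f: "strict_mono_on {..<l} f" "f ` {..<l} \<subseteq> {..<l'}"
    and m: "set_mset m \<subseteq> {..<l}" "image_mset f m \<subseteq># m'"
    using le unfolding shift_le_def by (elim bexE exE conjE) (rule that)
  have inj: "inj_on f {..<l}" using f(1) by (rule strict_mono_on_imp_inj_on)
  have p_pset: "p \<in> indexed_pset (\<Union>l\<in>Ls. {..<l}) (carrier R)" using shift_idealD(1)[OF J] p(1) by blast
  have supp: "set_mset n \<subseteq> {..<l}" if "p n \<noteq> \<zero>" for n
    using that p(2) m(1) by (auto simp: monomials_le_def dest!: multiset_le_imp_set_mset_bounded)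
  have p_l: "p \<in> indexed_pset {..<l} (carrier R)" using p_pset supp by (simp add: indexed_pset_iff)
  define r where "r = indexed_rename f p"
  have r: "r \<in> J" unfolding r_def by (rule shift_idealD(5)[OF J l f p(1) p_l])
  have r_pset: "r \<in> indexed_pset (\<Union>l\<in>Ls. {..<l}) (carrier R)" using shift_idealD(1)[OF J] r by blast
  have r_le: "n \<le> image_mset f m" if nz: "r n \<noteq> \<zero>" for n
  proof -
    obtain n' where n': "p n' \<noteq> \<zero>" "n = image_mset f n'"
      using nz unfolding r_def by (rule indexed_rename_support)
    show ?thesis unfolding n'(2)
    proof (rule image_mset_mono)
      show "\<forall>x\<in>set_mset n'. \<forall>y\<in>set_mset m. x < y \<longrightarrow> f x < f y"
        using f(1) supp[OF n'(1)] m(1) by (auto simp: strict_mono_on_def subset_iff)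
      show "n' \<le> m" using n'(1) p(2) by (simp add: monomials_le_def)
    qed
  qed
  define a where "a = m' - image_mset f m"
  have a: "m' = a + image_mset f m" using m(2) by (simp add: a_def)
  have a_sub: "set_mset a \<subseteq> (\<Union>l\<in>Ls. {..<l})" using m' unfolding a by auto
  define q where "q = indexed_mult (indexed_monom \<one> a) r"
  have q_eq: "q n = (if a \<subseteq># n then r (n - a) else \<zero>)" for n
    using indexed_mult_monom[OF one_closed r_pset, of a] indexed_pset_coeff[OF r_pset] by (simp add: q_def)
  have "q \<in> J" unfolding q_def
    using a_sub by (intro shift_idealD(4)[OF J _ r] indexed_monom_closed) auto
  moreover have "monomials_le q m'"
    unfolding monomials_le_def
  proof (intro allI impI)
    fix n assume "q n \<noteq> \<zero>"
    then have n: "a \<subseteq># n" "r (n - a) \<noteq> \<zero>" by (auto simp: q_eq split: if_splits)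
    then have "a + (n - a) \<le> a + image_mset f m" using r_le by (intro add_left_mono)
    then show "n \<le> m'" using n(1) by (simp add: a)
  qed
  moreover have "q m' = p m"
    using indexed_rename_image[OF p_l inj m(1)] by (simp add: q_eq a r_def)
  ultimately show ?thesis by blast
qed

text \<open>The leading term argument sketched at the beginning. It generalises Hilbert's basis theorem, which
is the case of a singleton \<open>Ls\<close>.\<close>

theorem shift_ideal_finitely_generated:
  assumes noeth: "noetherian_ring R" and ne: "Ls \<noteq> {}" and J: "shift_ideal Ls J"
  shows "\<exists>B\<subseteq>J. finite B \<and> (\<forall>J'. shift_ideal Ls J' \<and> B \<subseteq> J' \<longrightarrow> J \<subseteq> J')"
proof (rule ccontr)
  assume contra: "\<not> ?thesis"
  let ?D = "\<Union>l\<in>Ls. {..<l}"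
  let ?P = "indexed_pset ?D (carrier R)"
  define gen where "gen B = \<Inter>{J'. shift_ideal Ls J' \<and> B \<subseteq> J'}" for B
  have gen_ideal: "shift_ideal Ls (gen B)" if "B \<subseteq> J" for B
    unfolding gen_def using that J by (intro shift_ideal_Inter) auto
  have gen_sub: "B \<subseteq> gen B" for B by (auto simp: gen_def)
  have gen_le: "gen B \<subseteq> J" if "B \<subseteq> J" for B using that J by (auto simp: gen_def)
  have gen_mono: "gen B \<subseteq> gen B'" if "B \<subseteq> B'" for B B' using that by (auto simp: gen_def)
  have not_gen: "\<not> J \<subseteq> gen B" if "B \<subseteq> J" "finite B" for B
    using contra that unfolding gen_def by blast
  have J_pset: "p \<in> ?P" if "p \<in> J" for p using that shift_idealD(1)[OF J] by blast
  have leading: "\<exists>m. p m \<noteq> \<zero> \<and> monomials_le p m \<and> set_mset m \<subseteq> ?D"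
    if p: "p \<in> J" "p \<notin> gen B" "B \<subseteq> J" for p B
  proof -
    have fin: "finite {m. p m \<noteq> \<zero>}" using J_pset[OF p(1)] by (simp add: indexed_pset_iff)
    have "{m. p m \<noteq> \<zero>} \<noteq> {}"
    proof
      assume "{m. p m \<noteq> \<zero>} = {}"
      then have "p = (\<lambda>_. \<zero>)" by auto
      then show False using shift_idealD(2)[OF gen_ideal[OF p(3)]] p(2) by simp
    qed
    then have max: "p (Max {m. p m \<noteq> \<zero>}) \<noteq> \<zero>" using Max_in[OF fin] by simp
    show ?thesis
    proof (intro exI conjI)
      show "p (Max {m. p m \<noteq> \<zero>}) \<noteq> \<zero>" by (rule max)
      show "monomials_le p (Max {m. p m \<noteq> \<zero>})"
        using fin by (simp add: monomials_le_def)
      show "set_mset (Max {m. p m \<noteq> \<zero>}) \<subseteq> ?D"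
        using max J_pset[OF p(1)] unfolding indexed_pset_iff by blast
    qed
  qed
  \<comment> \<open>The next polynomial is an element of J outside the ideal generated by the finite set B,
    chosen together with the least possible bound on its monomials.\<close>
  define cand where "cand B p m \<longleftrightarrow> p \<in> J \<and> p \<notin> gen B \<and> monomials_le p m \<and> set_mset m \<subseteq> ?D" for B p m
  define lm where "lm B = (LEAST m. \<exists>p. cand B p m)" for B
  define pick where "pick B = (SOME p. cand B p (lm B))" for B
  have cand: "cand B (pick B) (lm B)" if B: "B \<subseteq> J" "finite B" for B
  proof -
    obtain p where p: "p \<in> J" "p \<notin> gen B" using not_gen[OF B] by blast
    obtain m where "monomials_le p m" "set_mset m \<subseteq> ?D" using leading[OF p B(1)] by blast
    then have "\<exists>p. cand B p m" using p unfolding cand_def by blast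
    then have "\<exists>p. cand B p (lm B)" unfolding lm_def by (rule LeastI)
    then show ?thesis unfolding pick_def by (rule someI_ex)
  qed
  have lm_le: "lm B \<le> m" if "cand B p m" for B p m
    unfolding lm_def using that by (intro Least_le) blast
  define B where "B = rec_nat {} (\<lambda>_ B. insert (pick B) B)"
  have B_Suc: "B (Suc i) = insert (pick (B i)) (B i)" for i by (simp add: B_def)
  have B: "B i \<subseteq> J \<and> finite (B i)" for i
  proof (induction i)
    case (Suc i)
    then show ?case using cand[of "B i"] by (simp add: B_Suc cand_def)
  qed (simp add: B_def)
  have B_mono: "B i \<subseteq> B j" if "i \<le> j" for i j
    using that by (rule lift_Suc_mono_le[of B, rotated]) (auto simp: B_Suc)
  define p m where "p i = pick (B i)" and "m i = lm (B i)" for i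
  have p: "p i \<in> J" "p i \<notin> gen (B i)" "monomials_le (p i) (m i)" "set_mset (m i) \<subseteq> ?D" for i
    using cand[of "B i"] B[of i] unfolding p_def m_def cand_def by blast+
  have p_in: "p i \<in> B j" if "i < j" for i j
    using B_mono[of "Suc i" j] that by (auto simp: B_Suc p_def)
  have "\<exists>\<phi> :: nat \<Rightarrow> nat. strict_mono \<phi> \<and> (\<forall>i j. i < j \<longrightarrow> shift_le Ls (m (\<phi> i)) (m (\<phi> j)))"
    by (rule shift_le_subsequence[OF ne p(4)])
  then obtain \<phi> :: "nat \<Rightarrow> nat"
    where \<phi>: "strict_mono \<phi> \<and> (\<forall>i j. i < j \<longrightarrow> shift_le Ls (m (\<phi> i)) (m (\<phi> j)))"
    by (elim exE) (rule that)
  define c where "c i = p (\<phi> i) (m (\<phi> i))" for i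
  have c: "c i \<in> carrier R" for i unfolding c_def by (rule indexed_pset_coeff[OF J_pset[OF p(1)]])
  \<comment> \<open>The ideals generated by initial segments of the leading coefficients form a chain, which
    stabilises since R is Noetherian.\<close>
  have "\<exists>n. c n \<in> Idl (c ` {..<n})"
  proof -
    let ?C = "range (\<lambda>n. Idl (c ` {..<n}))"
    have mono: "Idl (c ` {..<i}) \<subseteq> Idl (c ` {..<j})" if "i \<le> j" for i j
    proof (rule subset_Idl_subset)
      show "c ` {..<i} \<subseteq> c ` {..<j}" using that by auto
    qed (use c in auto)
    have "subset.chain {I. ideal I R} ?C"
      unfolding subset_chain_def using mono c
      by (auto intro!: genideal_ideal) (metis nat_le_linear subset_eq)
    then have "\<Union>?C \<in> ?C" by (intro noetherian_ring.ideal_chain_is_trivial[OF noeth]) auto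
    then obtain n where n: "\<Union>?C = Idl (c ` {..<n})" by auto
    have "c n \<in> Idl (c ` {..<Suc n})" using c by (intro genideal_self[THEN subsetD]) auto
    then have "c n \<in> \<Union>?C" by blast
    then show ?thesis using n by blast
  qed
  then obtain n where n: "c n \<in> Idl (c ` {..<n})" by blast
  define N where "N = \<phi> n"
  have G: "shift_ideal Ls (gen (B N))" using gen_ideal B by blast
  have "c ` {..<n} \<subseteq> {q (m N) |q. q \<in> gen (B N) \<and> monomials_le q (m N)}"
  proof
    fix x assume "x \<in> c ` {..<n}"
    then obtain j where j: "j < n" "x = c j" by blast
    have "\<phi> j < N" using \<phi> j(1) by (simp add: N_def strict_monoD)
    then have "p (\<phi> j) \<in> gen (B N)" using p_in gen_sub by blast
    moreover have "shift_le Ls (m (\<phi> j)) (m N)" using \<phi> j(1) by (simp add: N_def)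
    ultimately have "\<exists>q\<in>gen (B N). monomials_le q (m N) \<and> q (m N) = p (\<phi> j) (m (\<phi> j))"
      using leading_coeff_transfer[OF G _ p(3) _ p(4)] by blast
    then obtain q where "q \<in> gen (B N)" "monomials_le q (m N)" "q (m N) = p (\<phi> j) (m (\<phi> j))"
      by (elim bexE conjE) (rule that)
    then show "x \<in> {q (m N) |q. q \<in> gen (B N) \<and> monomials_le q (m N)}"
      by (intro CollectI exI[of _ q]) (simp add: j(2) c_def)
  qed
  then have "Idl (c ` {..<n}) \<subseteq> {q (m N) |q. q \<in> gen (B N) \<and> monomials_le q (m N)}"
    by (rule genideal_minimal[OF leading_coeff_ideal[OF G]])
  then obtain q where q: "q \<in> gen (B N)" "monomials_le q (m N)" "c n = q (m N)" using n by blast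
  have q_pset: "q \<in> ?P" using q(1) gen_le B J_pset by blast
  \<comment> \<open>q has the same leading term as p N; subtracting it leaves an element that is still
    outside the ideal generated by B N but whose leading monomial is smaller.\<close>
  define q' where "q' = (\<lambda>n. \<ominus> \<one> \<otimes> q n)"
  have q'_mult: "q' = indexed_mult (indexed_monom (\<ominus> \<one>) {#}) q"
    using q_pset by (simp add: indexed_mult_scalar q'_def)
  have q': "q' \<in> gen (B N)"
    unfolding q'_mult by (rule shift_idealD(4)[OF G indexed_monom_closed q(1)]) auto
  define r where "r = indexed_padd (p N) q'"
  have r_J: "r \<in> J" unfolding r_def
    using shift_idealD(3)[OF J p(1)] q' gen_le B by blast
  have coeffs [simp]: "p N k \<in> carrier R" "q k \<in> carrier R" for k
    using indexed_pset_coeff[OF J_pset[OF p(1)]] indexed_pset_coeff[OF q_pset] by auto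
  have r_gen: "r \<notin> gen (B N)"
  proof
    assume "r \<in> gen (B N)"
    then have "indexed_padd r q \<in> gen (B N)" using q(1) by (rule shift_idealD(3)[OF G])
    moreover have "indexed_padd r q = p N"
      by (auto simp: r_def q'_def indexed_padd_def l_minus a_assoc l_neg)
    ultimately show False using p(2) by simp
  qed
  have r_le: "monomials_le r (m N)"
    unfolding r_def q'_def by (intro monomials_le_add monomials_le_scalar p(3) q(2)) auto
  have r_zero: "r (m N) = \<zero>"
    using q(3) by (simp add: r_def q'_def indexed_padd_def l_minus c_def N_def[symmetric] r_neg)
  obtain m' where m': "r m' \<noteq> \<zero>" "monomials_le r m'" "set_mset m' \<subseteq> ?D"
    using leading[OF r_J r_gen] B by blast
  have "m N \<le> m'" unfolding m_def by (rule lm_le[of _ r]) (use r_J r_gen m' in \<open>simp add: cand_def\<close>)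
  moreover have "m' \<le> m N" using m'(1) r_le by (simp add: monomials_le_def)
  ultimately show False using m'(1) r_zero by simp
qed

end

section \<open>Indiscernible sequences for highly homogeneous actions\<close>

locale highly_homogeneous_action = group_action G S \<rho>
  for G :: "('g, 'n) monoid_scheme" (structure) and S :: "'s set" and \<rho> +
  assumes highly_homogeneous: "highly_homogeneous G S \<rho>"
begin

definition same_orbit :: "'s list \<Rightarrow> 's list \<Rightarrow> bool"
  where "same_orbit xs ys \<longleftrightarrow> (\<exists>g\<in>carrier G. ys = map (\<rho> g) xs)"

lemma group_G: "group G"
  using group_hom by (rule group_hom.axioms(1))

lemma same_orbit_sym:
  assumes "set xs \<subseteq> S" "same_orbit xs ys"
  shows "same_orbit ys xs"
proof -
  obtain g where g: "g \<in> carrier G" "ys = map (\<rho> g) xs" using assms(2) by (auto simp: same_orbit_def)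
  have "map (\<rho> (inv g)) ys = map (\<lambda>x. x) xs"
    unfolding g(2) map_map using assms(1) g(1) by (intro map_cong) (auto intro: orbit_sym_aux)
  then show ?thesis using g(1) group.inv_closed[OF group_G g(1)] by (auto simp: same_orbit_def intro!: bexI[of _ "inv g"])
qed

lemma same_orbit_trans:
  assumes "set xs \<subseteq> S" "same_orbit xs ys" "same_orbit ys zs"
  shows "same_orbit xs zs"
proof -
  obtain g h where g: "g \<in> carrier G" "ys = map (\<rho> g) xs" and h: "h \<in> carrier G" "zs = map (\<rho> h) ys"
    using assms by (auto simp: same_orbit_def)
  have "zs = map (\<rho> (h \<otimes> g)) xs"
    unfolding g(2) h(2) map_map using assms(1) g(1) h(1)
    by (intro map_cong) (auto simp: composition_rule subset_iff)
  moreover have "h \<otimes> g \<in> carrier G"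
    using group.is_monoid[OF group_G] g h by (simp add: monoid.m_closed)
  ultimately show ?thesis by (auto simp: same_orbit_def)
qed

lemma same_orbit_set: "set xs \<subseteq> S \<Longrightarrow> same_orbit xs ys \<Longrightarrow> set ys \<subseteq> S"
  by (auto simp: same_orbit_def subset_iff intro!: element_image[OF _ _ refl])

lemma same_orbit_distinct:
  assumes "set xs \<subseteq> S" "same_orbit xs ys" "distinct xs"
  shows "distinct ys"
proof -
  obtain g where g: "g \<in> carrier G" "ys = map (\<rho> g) xs" using assms(2) by (auto simp: same_orbit_def)
  then show ?thesis using inj_prop[OF g(1)] assms by (auto simp: distinct_map intro: inj_on_subset)
qed

context
  fixes e :: "nat \<Rightarrow> 's"
  assumes inj_e: "inj e" and range_e: "range e \<subseteq> S"
begin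

abbreviation tuple :: "nat set \<Rightarrow> 's list" where "tuple E \<equiv> map e (sorted_list_of_set E)"

definition homogeneous :: "nat \<Rightarrow> nat set \<Rightarrow> bool"
  where "homogeneous n Y \<longleftrightarrow> (\<forall>E E'. E \<subseteq> Y \<and> finite E \<and> card E = n \<and> E' \<subseteq> Y \<and> finite E' \<and> card E' = n
    \<longrightarrow> same_orbit (tuple E) (tuple E'))"

lemma tuple_in_S: "set (tuple E) \<subseteq> S"
  using range_e by auto

text \<open>Colour an \<open>n\<close>-element set of indices by the orbit of the corresponding increasing tuple. High
homogeneity makes the number of colours finite, because every orbit has a representative with
entries in the set of the first \<open>n\<close> terms of \<open>e\<close>. Ramsey's theorem applies.\<close>

lemma exists_homogeneous_subset:
  assumes "infinite Z"
  shows "\<exists>Y. Y \<subseteq> Z \<and> infinite Y \<and> homogeneous n Y"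
proof -
  define L where "L = {ys. set ys \<subseteq> e ` {..<n} \<and> length ys = n}"
  have "finite L" unfolding L_def by (rule finite_lists_length_eq) simp
  then obtain idx :: "'s list \<Rightarrow> nat" and s where idx: "idx ` L = {i. i < s}" "inj_on idx L"
    using finite_imp_inj_to_nat_seg by metis
  have "\<exists>ys\<in>L. same_orbit (tuple E) ys" if E: "finite E" "card E = n" for E
  proof -
    have "e ` E \<in> nsets S n" "e ` {..<n} \<in> nsets S n"
      using E range_e inj_e by (auto simp: nsets_def card_image inj_on_subset)
    then obtain g where g: "g \<in> carrier G" "\<rho> g ` e ` E = e ` {..<n}"
      using highly_homogeneous unfolding highly_homogeneous_def by meson
    then have "map (\<rho> g) (tuple E) \<in> L" using E by (auto simp: L_def)
    then show ?thesis using g(1) by (auto simp: same_orbit_def)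
  qed
  then obtain col where col: "\<And>E. finite E \<Longrightarrow> card E = n \<Longrightarrow> col E \<in> L \<and> same_orbit (tuple E) (col E)"
    by metis
  have "\<exists>Y t. Y \<subseteq> Z \<and> infinite Y \<and> t < s \<and> (\<forall>E. E \<subseteq> Y \<and> finite E \<and> card E = n \<longrightarrow> idx (col E) = t)"
    by (rule Ramsey[OF assms]) (use col idx in blast)
  then obtain Y t where Y: "Y \<subseteq> Z \<and> infinite Y"
    and t: "\<forall>E. E \<subseteq> Y \<and> finite E \<and> card E = n \<longrightarrow> idx (col E) = t"
    by (elim exE conjE) (rule that, rule conjI)
  have "homogeneous n Y"
    unfolding homogeneous_def
  proof (intro allI impI)
    fix E E' assume E: "E \<subseteq> Y \<and> finite E \<and> card E = n \<and> E' \<subseteq> Y \<and> finite E' \<and> card E' = n"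
    then have "idx (col E) = idx (col E')" using t by simp
    then have eq: "col E = col E'" using idx(2) col E by (metis inj_onD)
    have "same_orbit (tuple E) (col E)" "same_orbit (tuple E') (col E)" using col E eq by metis+
    then show "same_orbit (tuple E) (tuple E')"
      using same_orbit_sym same_orbit_trans tuple_in_S by blast
  qed
  then show ?thesis using Y by blast
qed

text \<open>A decreasing chain of infinite sets \<open>W n\<close>, homogeneous for \<open>n\<close>-tuples, singles out for
each \<open>n\<close> one orbit of \<open>n\<close>-tuples (those satisfying \<open>realizes n\<close>). These orbits are
coherent: passing from an increasing \<open>m\<close>-tuple to a subtuple of length \<open>n\<close> leads from the \<open>m\<close>-th
orbit to the \<open>n\<close>-th one. No infinite set of indices need be homogeneous for all \<open>n\<close> at once, so the
sequence \<open>t\<close> is not a subsequence of \<open>e\<close>. Instead its initial segments are built inside these orbits: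
a tuple in the \<open>n\<close>-th orbit is extended by taking any tuple in the next orbit and moving its first
\<open>n\<close> entries onto the given ones by an element of \<open>G\<close>.\<close>

lemma indiscernible_sequence_aux:
  shows "\<exists>t :: nat \<Rightarrow> 's. inj t \<and> range t \<subseteq> S \<and>
    (\<forall>n f. strict_mono_on {..<n} f \<longrightarrow> (\<exists>g\<in>carrier G. \<forall>i<n. \<rho> g (t i) = t (f i)))"
proof -
  have "\<exists>Z. \<forall>n. infinite (Z n) \<and> (Z (Suc n) \<subseteq> Z n \<and> homogeneous n (Z (Suc n)))"
  proof (rule dependent_nat_choice)
    show "\<exists>Z :: nat set. infinite Z" by (rule exI) (rule infinite_UNIV_nat)
    show "\<exists>Y. infinite Y \<and> Y \<subseteq> Z \<and> homogeneous n Y" if "infinite Z" for Z n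
      using exists_homogeneous_subset[OF that, of n] by (elim exE conjE) (intro exI conjI; assumption)
  qed
  then obtain Z where "\<forall>n. infinite (Z n) \<and> (Z (Suc n) \<subseteq> Z n \<and> homogeneous n (Z (Suc n)))"
    by (elim exE) (rule that)
  then have Z: "\<And>n. infinite (Z n)" "\<And>n. Z (Suc n) \<subseteq> Z n" "\<And>n. homogeneous n (Z (Suc n))"
    by simp_all
  define W where "W n = Z (Suc n)" for n
  have W: "infinite (W n)" "homogeneous n (W n)" for n using Z by (auto simp: W_def)
  have W_anti: "W m \<subseteq> W n" if "n \<le> m" for n m
    unfolding W_def by (rule lift_Suc_antimono_le[of Z, OF Z(2)]) (simp add: that)
  define realizes where "realizes n xs \<longleftrightarrow> (\<exists>E. E \<subseteq> W n \<and> finite E \<and> card E = n \<and> same_orbit (tuple E) xs)" for n xs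
  have realizes_same_orbit: "same_orbit xs ys" if xs: "realizes n xs" and ys: "realizes n ys" for n xs ys
  proof -
    obtain E E' where E: "E \<subseteq> W n" "finite E" "card E = n" "same_orbit (tuple E) xs"
      and E': "E' \<subseteq> W n" "finite E'" "card E' = n" "same_orbit (tuple E') ys"
      using xs ys unfolding realizes_def by (elim exE conjE) (rule that)
    have "same_orbit xs (tuple E)" using E(4) tuple_in_S by (rule same_orbit_sym[rotated])
    moreover have "same_orbit (tuple E) (tuple E')"
      using W(2)[of n] E E' unfolding homogeneous_def by blast
    ultimately show ?thesis
      using same_orbit_trans same_orbit_set tuple_in_S E(4) E'(4) by metis
  qed
  have realizes_length: "length xs = n" if "realizes n xs" for n xs
    using that by (auto simp: realizes_def same_orbit_def)
  have realizes_sub: "realizes n (map (\<lambda>i. xs ! f i) [0..<n])"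
    if xs: "realizes m xs" and "n \<le> m" and f: "strict_mono_on {..<n} f" "\<And>i. i < n \<Longrightarrow> f i < m" for n m xs f
  proof -
    obtain E g where E: "E \<subseteq> W m" "finite E" "card E = m" and g: "g \<in> carrier G" "xs = map (\<rho> g) (tuple E)"
      using xs unfolding realizes_def same_orbit_def by (elim exE conjE bexE) (rule that)
    define l where "l = sorted_list_of_set E"
    have l: "length l = m" "sorted_wrt (<) l" "set l = E" using E by (auto simp: l_def)
    define l' where "l' = map (\<lambda>i. l ! f i) [0..<n]"
    have "sorted_wrt (<) l'"
      unfolding sorted_wrt_iff_nth_less
    proof (intro allI impI)
      fix i j assume "i < j" "j < length l'"
      then have "f i < f j" "f j < m" using f by (auto simp: l'_def strict_mono_on_def)
      then have "l ! f i < l ! f j" using l by (simp add: sorted_wrt_iff_nth_less)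
      then show "l' ! i < l' ! j" using \<open>i < j\<close> \<open>j < length l'\<close> by (simp add: l'_def)
    qed
    then have l': "sorted_list_of_set (set l') = l'" "distinct l'"
      by (auto simp: strict_sorted_iff sorted_list_of_set.idem_if_sorted_distinct)
    have "set l' \<subseteq> W n"
      using l f(2) E(1) W_anti[OF \<open>n \<le> m\<close>] by (auto simp: l'_def) (meson nth_mem subsetD)
    moreover have "card (set l') = n" using l'(2) by (simp add: distinct_card) (simp add: l'_def)
    moreover have "map (\<lambda>i. xs ! f i) [0..<n] = map (\<rho> g) (tuple (set l'))"
      unfolding l'(1) using f(2) l(1) by (simp add: g(2) l_def[symmetric]) (simp add: l'_def)
    ultimately show ?thesis using g(1) unfolding realizes_def same_orbit_def by blast
  qed
  have "\<exists>xs. \<forall>n. realizes n (xs n) \<and> take n (xs (Suc n)) = xs n"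
  proof (rule dependent_nat_choice)
    show "\<exists>xs. realizes 0 xs"
      by (intro exI[of _ "[]"]) (use group.is_monoid[OF group_G] monoid.one_closed in \<open>force simp: realizes_def same_orbit_def\<close>)
    fix xs n assume xs: "realizes n xs"
    obtain E where E: "E \<subseteq> W (Suc n)" "finite E" "card E = Suc n"
      using W(1) infinite_arbitrarily_large by metis
    define us where "us = tuple E"
    have us: "realizes (Suc n) us"
      using E W(2)[of "Suc n"] unfolding realizes_def homogeneous_def us_def by meson
    have "realizes n (map (\<lambda>i. us ! i) [0..<n])"
      using us by (rule realizes_sub) (auto simp: strict_mono_on_def)
    moreover have "map (\<lambda>i. us ! i) [0..<n] = take n us"
      using realizes_length[OF us] by (intro nth_equalityI) auto
    ultimately have "same_orbit (take n us) xs" using realizes_same_orbit[OF _ xs] by simp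
    then obtain g where g: "g \<in> carrier G" "xs = map (\<rho> g) (take n us)" by (auto simp: same_orbit_def)
    have "same_orbit us (map (\<rho> g) us)" using g(1) by (auto simp: same_orbit_def)
    then have "realizes (Suc n) (map (\<rho> g) us)"
      using us same_orbit_trans[OF tuple_in_S] unfolding realizes_def by meson
    moreover have "take n (map (\<rho> g) us) = xs" by (simp add: g(2) take_map)
    ultimately show "\<exists>ys. realizes (Suc n) ys \<and> take n ys = xs" by blast
  qed
  then obtain xs where xs: "\<And>n. realizes n (xs n)" "\<And>n. take n (xs (Suc n)) = xs n" by blast
  define t where "t i = xs (Suc i) ! i" for i
  have xs_t: "xs n = map t [0..<n]" for n
  proof (induction n)
    case 0
    then show ?case using realizes_length[OF xs(1)[of 0]] by simp
  next
    case (Suc n)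
    have len: "length (xs (Suc n)) = Suc n" using realizes_length[OF xs(1)] .
    have "xs (Suc n) = take n (xs (Suc n)) @ [xs (Suc n) ! n]"
      using len by (metis lessI order_refl take_Suc_conv_app_nth take_all)
    then show ?case using Suc xs(2)[of n] by (simp add: t_def)
  qed
  have xs_S: "set (xs n) \<subseteq> S" "distinct (xs n)" for n
  proof -
    obtain E where "finite E" "same_orbit (tuple E) (xs n)" using xs(1)[of n] by (auto simp: realizes_def)
    moreover have "distinct (tuple E)" using inj_e by (simp add: distinct_map inj_on_subset[OF _ subset_UNIV])
    ultimately show "set (xs n) \<subseteq> S" "distinct (xs n)"
      using same_orbit_set same_orbit_distinct tuple_in_S by blast+
  qed
  show ?thesis
  proof (intro exI[of _ t] conjI allI impI)
    show "inj t"
    proof (rule linorder_injI)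
      fix i j :: nat assume "i < j"
      then have "t i \<in> t ` {0..<j}" by simp
      moreover have "t j \<notin> t ` {0..<j}" using xs_S(2)[of "Suc j"] by (simp add: xs_t)
      ultimately show "t i \<noteq> t j" by metis
    qed
    show "range t \<subseteq> S" using xs_S(1)[of "Suc _"] by (auto simp: xs_t)
    show "\<exists>g\<in>carrier G. \<forall>i<n. \<rho> g (t i) = t (f i)" if f: "strict_mono_on {..<n} f" for n f
    proof -
      obtain m where m: "n \<le> m" "\<And>i. i < n \<Longrightarrow> f i < m"
      proof
        show "n \<le> n + Suc (\<Sum>i<n. f i)" by simp
        show "f i < n + Suc (\<Sum>i<n. f i)" if "i < n" for i
          using that member_le_sum[of i "{..<n}" f] by simp
      qed
      have "realizes n (map (\<lambda>i. xs m ! f i) [0..<n])"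
        using xs(1) m(1) f m(2) by (rule realizes_sub)
      moreover have "map (\<lambda>i. xs m ! f i) [0..<n] = map (\<lambda>i. t (f i)) [0..<n]"
        using m(2) by (simp add: xs_t)
      ultimately have "realizes n (map (\<lambda>i. t (f i)) [0..<n])" by (simp only:)
      moreover have "realizes n (map t [0..<n])" using xs(1)[of n] by (simp only: xs_t)
      ultimately have "same_orbit (map t [0..<n]) (map (\<lambda>i. t (f i)) [0..<n])"
        by (rule realizes_same_orbit[rotated])
      then show ?thesis by (auto simp: same_orbit_def)
    qed
  qed
qed

end

lemma indiscernible_sequence:
  assumes "infinite S"
  shows "\<exists>t :: nat \<Rightarrow> 's. inj t \<and> range t \<subseteq> S \<and>
    (\<forall>n f. strict_mono_on {..<n} f \<longrightarrow> (\<exists>g\<in>carrier G. \<forall>i<n. \<rho> g (t i) = t (f i)))"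
proof -
  obtain e :: "nat \<Rightarrow> 's" where "inj e" "range e \<subseteq> S"
    using infinite_countable_subset[OF assms] by blast
  then show ?thesis by (rule indiscernible_sequence_aux)
qed

end

lemma strict_mono_on_lessThan_eq_id:
  fixes f :: "nat \<Rightarrow> nat"
  assumes mono: "strict_mono_on {..<n} f" and range: "f ` {..<n} \<subseteq> {..<n}" and i: "i < n"
  shows "f i = i"
proof -
  have mono': "f i < f j" if "i < j" "j < n" for i j
    using mono that by (auto simp: strict_mono_on_def)
  have ge: "i \<le> f i" if "i < n" for i
    using that
  proof (induction i)
    case (Suc i)
    then show ?case using mono'[of i "Suc i"] by simp
  qed simp
  have "f i + d \<le> f (i + d)" if "i + d < n" for d
    using that
  proof (induction d)
    case (Suc d)
    then show ?case using mono'[of "i + d" "i + Suc d"] by simp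
  qed simp
  from this[of "n - 1 - i"] i have "f i + (n - 1 - i) \<le> f (n - 1)" by simp
  moreover have "f (n - 1) < n" using range i by (auto simp: image_subset_iff)
  ultimately show ?thesis using ge[OF i] i by linarith
qed

text \<open>Both cases of the comparison with polynomials in \<open>x\<^sub>0, x\<^sub>1, \<dots>\<close> in one statement: the variables are
embedded into \<open>S\<close> by \<open>t\<close>, all shifts are induced by \<open>G\<close>, and every finite subset of \<open>S\<close> can be moved
into the image of \<open>t\<close>. For finite \<open>S\<close>, the only shift is the identity
(\<open>strict_mono_on_lessThan_eq_id\<close>), induced by the neutral element.\<close>

lemma (in highly_homogeneous_action) coordinate_sequence:
  "\<exists>(Ls :: nat set) t. Ls \<noteq> {} \<and> inj_on t (\<Union>l\<in>Ls. {..<l}) \<and> t ` (\<Union>l\<in>Ls. {..<l}) \<subseteq> S \<and>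
    (\<forall>l\<in>Ls. \<forall>l'\<in>Ls. \<forall>f. strict_mono_on {..<l} f \<and> f ` {..<l} \<subseteq> {..<l'} \<longrightarrow>
      (\<exists>g\<in>carrier G. \<forall>i<l. \<rho> g (t i) = t (f i))) \<and>
    (\<forall>V. finite V \<and> V \<subseteq> S \<longrightarrow> (\<exists>g\<in>carrier G. \<rho> g ` V \<subseteq> t ` (\<Union>l\<in>Ls. {..<l})))"
proof (cases "finite S")
  case True
  obtain t where t: "bij_betw t {0..<card S} S" using ex_bij_betw_nat_finite[OF True] by blast
  have one: "\<one> \<in> carrier G" using group_G by (simp add: group.is_monoid monoid.one_closed)
  have id: "\<rho> \<one> s = s" if "s \<in> S" for s using id_eq_one that by (metis restrict_apply')
  show ?thesis
  proof (intro exI conjI allI ballI impI)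
    show "{card S} \<noteq> {}" by simp
    show "inj_on t (\<Union>l\<in>{card S}. {..<l})" "t ` (\<Union>l\<in>{card S}. {..<l}) \<subseteq> S"
      using t by (auto simp: bij_betw_def lessThan_atLeast0)
    show "\<exists>g\<in>carrier G. \<forall>i<l. \<rho> g (t i) = t (f i)"
      if "l \<in> {card S}" "l' \<in> {card S}" "strict_mono_on {..<l} f \<and> f ` {..<l} \<subseteq> {..<l'}" for l l' f
    proof (intro bexI[OF _ one] allI impI)
      fix i assume i: "i < l"
      then have "f i = i" using that by (intro strict_mono_on_lessThan_eq_id[of l]) auto
      moreover have "t i \<in> S" using t i that(1) by (auto simp: bij_betw_def)
      ultimately show "\<rho> \<one> (t i) = t (f i)" by (simp add: id)
    qed
    show "\<exists>g\<in>carrier G. \<rho> g ` V \<subseteq> t ` (\<Union>l\<in>{card S}. {..<l})" if "finite V \<and> V \<subseteq> S" for V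
    proof (intro bexI[OF _ one])
      have "t ` (\<Union>l\<in>{card S}. {..<l}) = S" using t by (simp add: bij_betw_def lessThan_atLeast0)
      then show "\<rho> \<one> ` V \<subseteq> t ` (\<Union>l\<in>{card S}. {..<l})" using that id by auto
    qed
  qed
next
  case False
  obtain t :: "nat \<Rightarrow> 's" where t: "inj t \<and> range t \<subseteq> S \<and>
    (\<forall>n f. strict_mono_on {..<n} f \<longrightarrow> (\<exists>g\<in>carrier G. \<forall>i<n. \<rho> g (t i) = t (f i)))"
    using indiscernible_sequence[OF False] by (elim exE) (rule that)
  have UN: "(\<Union>l\<in>UNIV. {..<l}) = (UNIV :: nat set)" by auto
  show ?thesis
  proof (intro exI conjI allI ballI impI)
    show "(UNIV :: nat set) \<noteq> {}" by simp
    show "inj_on t (\<Union>l\<in>UNIV. {..<l})" "t ` (\<Union>l\<in>UNIV. {..<l}) \<subseteq> S"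
      using t by (simp_all add: UN)
    show "\<exists>g\<in>carrier G. \<forall>i<l. \<rho> g (t i) = t (f i)"
      if "strict_mono_on {..<l} f \<and> f ` {..<l} \<subseteq> {..<l'}" for l l' f
      using t that by simp
    show "\<exists>g\<in>carrier G. \<rho> g ` V \<subseteq> t ` (\<Union>l\<in>UNIV. {..<l})" if V: "finite V \<and> V \<subseteq> S" for V
    proof -
      have "V \<in> nsets S (card V)" "t ` {..<card V} \<in> nsets S (card V)"
        using t V by (auto simp: nsets_def card_image inj_on_subset)
      then obtain g where "g \<in> carrier G" "\<rho> g ` V = t ` {..<card V}"
        using highly_homogeneous unfolding highly_homogeneous_def by meson
      then show ?thesis by (intro bexI[of _ g]) auto
    qed
  qed
qed

section \<open>Skew group rings and their natural modules\<close>

locale group_acting_on_ring = ring A + G: group G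
  for A :: "('a, 'm) ring_scheme" (structure) and G :: "('g, 'n) monoid_scheme" +
  fixes \<alpha> :: "'g \<Rightarrow> 'a \<Rightarrow> 'a"
  assumes act_hom: "g \<in> carrier G \<Longrightarrow> \<alpha> g \<in> ring_hom A A"
    and act_one: "x \<in> carrier A \<Longrightarrow> \<alpha> \<one>\<^bsub>G\<^esub> x = x"
    and act_mult: "\<lbrakk>g \<in> carrier G; h \<in> carrier G; x \<in> carrier A\<rbrakk> \<Longrightarrow> \<alpha> (g \<otimes>\<^bsub>G\<^esub> h) x = \<alpha> g (\<alpha> h x)"
begin

abbreviation Skew where "Skew \<equiv> skew_group_ring A G \<alpha>"

abbreviation SkewMod where "SkewMod \<equiv> skew_group_module A \<alpha>"

text \<open>The common shape of the product in the skew group ring (for \<open>w g = \<alpha> g (f' (g\<inverse> x))\<close>, see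
\<open>Skew_mult\<close>) and of its action on the ring (for \<open>w g = \<alpha> g p\<close>). Facts about this sum
serve both purposes.\<close>

definition weighted_sum :: "('g \<Rightarrow> 'a) \<Rightarrow> ('g \<Rightarrow> 'a) \<Rightarrow> 'a"
  where "weighted_sum f w = (\<Oplus>g\<in>{g. f g \<noteq> \<zero>}. f g \<otimes> w g)"

lemma act_closed [simp]: "g \<in> carrier G \<Longrightarrow> x \<in> carrier A \<Longrightarrow> \<alpha> g x \<in> carrier A"
  by (rule ring_hom_closed[OF act_hom])

lemma act_zero [simp]: "g \<in> carrier G \<Longrightarrow> \<alpha> g \<zero> = \<zero>"
  using act_hom by (simp add: ring_hom_zero ring_axioms)

lemma act_finsum:
  assumes "g \<in> carrier G" "f \<in> F \<rightarrow> carrier A"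
  shows "\<alpha> g (\<Oplus>i\<in>F. f i) = (\<Oplus>i\<in>F. \<alpha> g (f i))"
proof -
  interpret ring_hom_ring A A "\<alpha> g"
    using assms(1) act_hom ring_axioms by (intro ring_hom_ringI2)
  show ?thesis using hom_finsum[OF assms(2)] by (simp add: comp_def)
qed

lemma Skew_iff:
  "f \<in> carrier Skew \<longleftrightarrow> (\<forall>g. f g \<in> carrier A) \<and> finite {g. f g \<noteq> \<zero>} \<and> (\<forall>g. f g \<noteq> \<zero> \<longrightarrow> g \<in> carrier G)"
  by (auto simp: skew_group_ring_def)

lemma Skew_coeff [simp]: "f \<in> carrier Skew \<Longrightarrow> f g \<in> carrier A"
  by (simp add: Skew_iff)

lemma weighted_sum_superset:
  assumes f: "f \<in> carrier Skew" and w: "w \<in> carrier G \<rightarrow> carrier A"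
    and F: "finite F" "F \<subseteq> carrier G" "\<And>g. f g \<noteq> \<zero> \<Longrightarrow> g \<in> F"
  shows "weighted_sum f w = (\<Oplus>g\<in>F. f g \<otimes> w g)"
  unfolding weighted_sum_def
proof (rule add.finprod_mono_neutral_cong_left)
  show "f i \<otimes> w i = \<zero>" if "i \<in> F - {g. f g \<noteq> \<zero>}" for i
    using that F(2) w by (auto simp: Pi_iff subset_iff)
qed (use f w F in \<open>auto simp: Pi_iff subset_iff\<close>)

lemma weighted_sum_closed:
  assumes f: "f \<in> carrier Skew" and w: "w \<in> carrier G \<rightarrow> carrier A"
  shows "weighted_sum f w \<in> carrier A"
  using assms unfolding weighted_sum_def by (auto simp: Skew_iff intro!: finsum_closed)

lemma weighted_sum_cong:
  assumes f: "f \<in> carrier Skew" and w: "w \<in> carrier G \<rightarrow> carrier A"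
    and eq: "\<And>g. g \<in> carrier G \<Longrightarrow> w' g = w g"
  shows "weighted_sum f w' = weighted_sum f w"
  unfolding weighted_sum_def using assms by (intro finsum_cong') (auto simp: Skew_iff Pi_iff)

lemma weighted_sum_add_right:
  assumes f: "f \<in> carrier Skew"
    and w: "w \<in> carrier G \<rightarrow> carrier A" "w' \<in> carrier G \<rightarrow> carrier A"
  shows "weighted_sum f (\<lambda>g. w g \<oplus> w' g) = weighted_sum f w \<oplus> weighted_sum f w'"
proof -
  have "weighted_sum f (\<lambda>g. w g \<oplus> w' g) = (\<Oplus>g\<in>{g. f g \<noteq> \<zero>}. f g \<otimes> w g \<oplus> f g \<otimes> w' g)"
    unfolding weighted_sum_def using assms
    by (intro finsum_cong') (auto simp: Skew_iff Pi_iff r_distr)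
  also have "\<dots> = weighted_sum f w \<oplus> weighted_sum f w'"
    unfolding weighted_sum_def using assms by (intro finsum_addf) (auto simp: Skew_iff Pi_iff)
  finally show ?thesis .
qed

lemma Skew_add_closed:
  assumes "f \<in> carrier Skew" "f' \<in> carrier Skew"
  shows "(\<lambda>g. f g \<oplus> f' g) \<in> carrier Skew"
proof -
  have "{g. f g \<oplus> f' g \<noteq> \<zero>} \<subseteq> {g. f g \<noteq> \<zero>} \<union> {g. f' g \<noteq> \<zero>}" by auto
  then have "finite {g. f g \<oplus> f' g \<noteq> \<zero>}"
    using assms by (auto simp: Skew_iff intro: finite_subset)
  moreover have "g \<in> carrier G" if "f g \<oplus> f' g \<noteq> \<zero>" for g
    using that assms by (metis Skew_iff l_zero zero_closed)
  ultimately show ?thesis using assms by (simp add: Skew_iff)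
qed

lemma weighted_sum_add_left:
  assumes f: "f \<in> carrier Skew" "f' \<in> carrier Skew" and w: "w \<in> carrier G \<rightarrow> carrier A"
  shows "weighted_sum (\<lambda>g. f g \<oplus> f' g) w = weighted_sum f w \<oplus> weighted_sum f' w"
proof -
  let ?F = "{g. f g \<noteq> \<zero>} \<union> {g. f' g \<noteq> \<zero>}"
  have F: "finite ?F" "?F \<subseteq> carrier G" using f by (auto simp: Skew_iff)
  have [simp]: "w g \<in> carrier A" if "g \<in> ?F" for g using that F w by auto
  have "weighted_sum (\<lambda>g. f g \<oplus> f' g) w = (\<Oplus>g\<in>?F. (f g \<oplus> f' g) \<otimes> w g)"
    using f w F by (intro weighted_sum_superset Skew_add_closed) auto
  also have "\<dots> = (\<Oplus>g\<in>?F. f g \<otimes> w g \<oplus> f' g \<otimes> w g)"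
    using f by (intro finsum_cong') (auto simp: l_distr)
  also have "\<dots> = (\<Oplus>g\<in>?F. f g \<otimes> w g) \<oplus> (\<Oplus>g\<in>?F. f' g \<otimes> w g)"
    using f by (intro finsum_addf) auto
  also have "\<dots> = weighted_sum f w \<oplus> weighted_sum f' w"
    using f w F by (simp add: weighted_sum_superset[OF f(1) w F] weighted_sum_superset[OF f(2) w F])
  finally show ?thesis .
qed

definition single :: "'a \<Rightarrow> 'g \<Rightarrow> 'g \<Rightarrow> 'a"
  where "single a g = (\<lambda>x. if x = g then a else \<zero>)"

lemma single_closed: "a \<in> carrier A \<Longrightarrow> g \<in> carrier G \<Longrightarrow> single a g \<in> carrier Skew"
  by (auto simp: Skew_iff single_def)

lemma weighted_sum_single:
  assumes "a \<in> carrier A" "g \<in> carrier G" "w \<in> carrier G \<rightarrow> carrier A"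
  shows "weighted_sum (single a g) w = a \<otimes> w g"
proof -
  have "weighted_sum (single a g) w = (\<Oplus>x\<in>{g}. single a g x \<otimes> w x)"
    using assms by (intro weighted_sum_superset single_closed) (auto simp: single_def split: if_splits)
  then show ?thesis using assms by (simp add: single_def Pi_iff)
qed

lemma Skew_mult:
  assumes f: "f \<in> carrier Skew" and f': "f' \<in> carrier Skew"
  shows "(f \<otimes>\<^bsub>Skew\<^esub> f') x =
    (if x \<in> carrier G then weighted_sum f (\<lambda>g. \<alpha> g (f' (inv\<^bsub>G\<^esub> g \<otimes>\<^bsub>G\<^esub> x))) else \<zero>)"
proof -
  define T where "T = {(g, h). f g \<noteq> \<zero> \<and> f' h \<noteq> \<zero> \<and> g \<otimes>\<^bsub>G\<^esub> h = x}"
  have mult: "(f \<otimes>\<^bsub>Skew\<^esub> f') x = finsum A (\<lambda>(g, h). f g \<otimes> \<alpha> g (f' h)) T"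
    by (simp add: skew_group_ring_def T_def)
  have supp: "f g \<noteq> \<zero> \<Longrightarrow> g \<in> carrier G" "f' g \<noteq> \<zero> \<Longrightarrow> g \<in> carrier G" for g
    using f f' by (auto simp: Skew_iff)
  show ?thesis
  proof (cases "x \<in> carrier G")
    case False
    then have "T = {}" using supp by (auto simp: T_def)
    then show ?thesis using False by (simp add: mult)
  next
    case True
    define H where "H = {g. f g \<noteq> \<zero> \<and> f' (inv\<^bsub>G\<^esub> g \<otimes>\<^bsub>G\<^esub> x) \<noteq> \<zero>}"
    let ?j = "\<lambda>g. (g, inv\<^bsub>G\<^esub> g \<otimes>\<^bsub>G\<^esub> x)"
    have T: "T = ?j ` H"
    proof (intro equalityI subsetI)
      fix y assume "y \<in> T"
      then obtain g h where y: "y = (g, h)" "f g \<noteq> \<zero>" "f' h \<noteq> \<zero>" "g \<otimes>\<^bsub>G\<^esub> h = x"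
        by (auto simp: T_def)
      then have "h = inv\<^bsub>G\<^esub> g \<otimes>\<^bsub>G\<^esub> x" using supp True by (metis G.inv_solve_left)
      then show "y \<in> ?j ` H" using y by (auto simp: H_def)
    next
      fix y assume "y \<in> ?j ` H"
      then obtain g where "y = ?j g" "f g \<noteq> \<zero>" "f' (inv\<^bsub>G\<^esub> g \<otimes>\<^bsub>G\<^esub> x) \<noteq> \<zero>"
        by (auto simp: H_def)
      moreover have "g \<otimes>\<^bsub>G\<^esub> (inv\<^bsub>G\<^esub> g \<otimes>\<^bsub>G\<^esub> x) = x"
        using supp True calculation by (metis G.inv_closed G.inv_solve_left' G.m_closed)
      ultimately show "y \<in> T" by (auto simp: T_def)
    qed
    have H: "H \<subseteq> carrier G" using supp by (auto simp: H_def)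
    have "finsum A (\<lambda>(g, h). f g \<otimes> \<alpha> g (f' h)) T = (\<Oplus>g\<in>H. f g \<otimes> \<alpha> g (f' (inv\<^bsub>G\<^esub> g \<otimes>\<^bsub>G\<^esub> x)))"
      unfolding T using f f' H by (subst finsum_reindex) (auto simp: inj_on_def)
    also have "\<dots> = weighted_sum f (\<lambda>g. \<alpha> g (f' (inv\<^bsub>G\<^esub> g \<otimes>\<^bsub>G\<^esub> x)))"
      unfolding weighted_sum_def
    proof (rule add.finprod_mono_neutral_cong_left)
      show "finite {g. f g \<noteq> \<zero>}" using f by (simp add: Skew_iff)
      show "H \<subseteq> {g. f g \<noteq> \<zero>}" by (auto simp: H_def)
      show "f i \<otimes> \<alpha> i (f' (inv\<^bsub>G\<^esub> i \<otimes>\<^bsub>G\<^esub> x)) = \<zero>" if "i \<in> {g. f g \<noteq> \<zero>} - H" for i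
        using that f supp by (auto simp: H_def)
    qed (use f f' supp in auto)
    finally show ?thesis using True by (simp add: mult)
  qed
qed

lemma Skew_mult_support:
  assumes f: "f \<in> carrier Skew" and f': "f' \<in> carrier Skew" and nz: "(f \<otimes>\<^bsub>Skew\<^esub> f') x \<noteq> \<zero>"
  shows "\<exists>g h. f g \<noteq> \<zero> \<and> f' h \<noteq> \<zero> \<and> x = g \<otimes>\<^bsub>G\<^esub> h"
proof (rule ccontr)
  assume "\<not> ?thesis"
  then have empty: "{(g, h). f g \<noteq> \<zero> \<and> f' h \<noteq> \<zero> \<and> g \<otimes>\<^bsub>G\<^esub> h = x} = {}" by auto
  have "(f \<otimes>\<^bsub>Skew\<^esub> f') x = finsum A (\<lambda>(g, h). f g \<otimes> \<alpha> g (f' h)) {}"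
    unfolding empty[symmetric] by (simp add: skew_group_ring_def)
  then show False using nz by simp
qed

lemma shifted_weight:
  assumes "f \<in> carrier Skew" "x \<in> carrier G"
  shows "(\<lambda>g. \<alpha> g (f (inv\<^bsub>G\<^esub> g \<otimes>\<^bsub>G\<^esub> x))) \<in> carrier G \<rightarrow> carrier A"
  using assms by auto

lemma Skew_mult_closed:
  assumes f: "f \<in> carrier Skew" and f': "f' \<in> carrier Skew"
  shows "f \<otimes>\<^bsub>Skew\<^esub> f' \<in> carrier Skew"
proof -
  have "{x. (f \<otimes>\<^bsub>Skew\<^esub> f') x \<noteq> \<zero>} \<subseteq> (\<lambda>(g, h). g \<otimes>\<^bsub>G\<^esub> h) ` ({g. f g \<noteq> \<zero>} \<times> {g. f' g \<noteq> \<zero>})"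
    using Skew_mult_support[OF f f'] by fastforce
  then have "finite {x. (f \<otimes>\<^bsub>Skew\<^esub> f') x \<noteq> \<zero>}"
    by (rule finite_subset) (use f f' in \<open>simp add: Skew_iff\<close>)
  moreover have "(f \<otimes>\<^bsub>Skew\<^esub> f') x \<in> carrier A" for x
    using f f' by (simp add: Skew_mult weighted_sum_closed shifted_weight)
  moreover have "x \<in> carrier G" if "(f \<otimes>\<^bsub>Skew\<^esub> f') x \<noteq> \<zero>" for x
    using that Skew_mult[OF f f'] by (metis (full_types))
  ultimately show ?thesis by (simp add: Skew_iff)
qed

text \<open>This one computation contains the associativity of the product in the skew group ring and the
associativity of its action: both weights \<open>w\<close> satisfy \<open>w (h k) = \<alpha> h (v h k)\<close> for a weight \<open>v h\<close> of
the same kind.\<close>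

lemma weighted_sum_mult:
  assumes f: "f \<in> carrier Skew" and f': "f' \<in> carrier Skew"
    and v: "\<And>h k. h \<in> carrier G \<Longrightarrow> k \<in> carrier G \<Longrightarrow> v h k \<in> carrier A"
    and w: "\<And>h k. h \<in> carrier G \<Longrightarrow> k \<in> carrier G \<Longrightarrow> w (h \<otimes>\<^bsub>G\<^esub> k) = \<alpha> h (v h k)"
    and w_closed: "w \<in> carrier G \<rightarrow> carrier A"
  shows "weighted_sum (f \<otimes>\<^bsub>Skew\<^esub> f') w = weighted_sum f (\<lambda>h. \<alpha> h (weighted_sum f' (v h)))"
proof -
  define H K where "H = {g. f g \<noteq> \<zero>}" and "K = {g. f' g \<noteq> \<zero>}"
  define F where "F = (\<lambda>(h, k). h \<otimes>\<^bsub>G\<^esub> k) ` (H \<times> K)"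
  have H: "finite H" "H \<subseteq> carrier G" and K: "finite K" "K \<subseteq> carrier G"
    using f f' by (auto simp: Skew_iff H_def K_def)
  then have F: "finite F" "F \<subseteq> carrier G" by (auto simp: F_def)
  have [simp]: "h \<in> carrier G" if "h \<in> H" for h using that H by auto
  have [simp]: "k \<in> carrier G" if "k \<in> K" for k using that K by auto
  have [simp]: "g \<in> carrier G" if "g \<in> F" for g using that F by auto
  have [simp]: "w g \<in> carrier A" if "g \<in> carrier G" for g using that w_closed by auto
  note [simp] = f f' v
  have inner: "(\<Oplus>g\<in>F. f h \<otimes> \<alpha> h (f' (inv\<^bsub>G\<^esub> h \<otimes>\<^bsub>G\<^esub> g)) \<otimes> w g) = f h \<otimes> \<alpha> h (weighted_sum f' (v h))"
    if h: "h \<in> H" for h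
  proof -
    have inj: "inj_on (\<lambda>k. h \<otimes>\<^bsub>G\<^esub> k) K"
      using h by (auto simp: inj_on_def)
    have "(\<Oplus>g\<in>F. f h \<otimes> \<alpha> h (f' (inv\<^bsub>G\<^esub> h \<otimes>\<^bsub>G\<^esub> g)) \<otimes> w g)
        = (\<Oplus>g\<in>(\<lambda>k. h \<otimes>\<^bsub>G\<^esub> k) ` K. f h \<otimes> \<alpha> h (f' (inv\<^bsub>G\<^esub> h \<otimes>\<^bsub>G\<^esub> g)) \<otimes> w g)"
    proof (rule add.finprod_mono_neutral_cong_right)
      show "(\<lambda>k. h \<otimes>\<^bsub>G\<^esub> k) ` K \<subseteq> F" using h by (auto simp: F_def)
      show "f h \<otimes> \<alpha> h (f' (inv\<^bsub>G\<^esub> h \<otimes>\<^bsub>G\<^esub> g)) \<otimes> w g = \<zero>" if g: "g \<in> F - (\<lambda>k. h \<otimes>\<^bsub>G\<^esub> k) ` K" for g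
      proof -
        have "g = h \<otimes>\<^bsub>G\<^esub> (inv\<^bsub>G\<^esub> h \<otimes>\<^bsub>G\<^esub> g)" using h g by (simp flip: G.m_assoc)
        then have "f' (inv\<^bsub>G\<^esub> h \<otimes>\<^bsub>G\<^esub> g) = \<zero>" using g by (auto simp: K_def)
        then show ?thesis using h g by simp
      qed
    qed (use h F in auto)
    also have "\<dots> = (\<Oplus>k\<in>K. f h \<otimes> \<alpha> h (f' k \<otimes> v h k))"
    proof -
      have "f h \<otimes> \<alpha> h (f' (inv\<^bsub>G\<^esub> h \<otimes>\<^bsub>G\<^esub> (h \<otimes>\<^bsub>G\<^esub> k))) \<otimes> w (h \<otimes>\<^bsub>G\<^esub> k) = f h \<otimes> \<alpha> h (f' k \<otimes> v h k)"
        if "k \<in> K" for k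
        using h that ring_hom_mult[OF act_hom[of h], of "f' k" "v h k"]
        by (simp add: w m_assoc flip: G.m_assoc)
      then show ?thesis
        using h by (subst finsum_reindex[OF _ inj]) (auto intro!: finsum_cong')
    qed
    also have "\<dots> = f h \<otimes> (\<Oplus>k\<in>K. \<alpha> h (f' k \<otimes> v h k))"
      using h K by (subst finsum_rdistr) auto
    also have "(\<Oplus>k\<in>K. \<alpha> h (f' k \<otimes> v h k)) = \<alpha> h (weighted_sum f' (v h))"
      unfolding weighted_sum_def using h by (subst act_finsum) (auto simp: K_def[symmetric])
    finally show ?thesis .
  qed
  have "weighted_sum (f \<otimes>\<^bsub>Skew\<^esub> f') w = (\<Oplus>g\<in>F. (f \<otimes>\<^bsub>Skew\<^esub> f') g \<otimes> w g)"
  proof (rule weighted_sum_superset)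
    show "g \<in> F" if "(f \<otimes>\<^bsub>Skew\<^esub> f') g \<noteq> \<zero>" for g
      using Skew_mult_support[OF f f' that] by (auto simp: F_def H_def K_def)
  qed (use F w_closed in \<open>auto simp: Skew_mult_closed\<close>)
  also have "\<dots> = (\<Oplus>g\<in>F. \<Oplus>h\<in>H. f h \<otimes> \<alpha> h (f' (inv\<^bsub>G\<^esub> h \<otimes>\<^bsub>G\<^esub> g)) \<otimes> w g)"
  proof (rule finsum_cong')
    show "(f \<otimes>\<^bsub>Skew\<^esub> f') g \<otimes> w g = (\<Oplus>h\<in>H. f h \<otimes> \<alpha> h (f' (inv\<^bsub>G\<^esub> h \<otimes>\<^bsub>G\<^esub> g)) \<otimes> w g)" if "g \<in> F" for g
      using that H by (subst finsum_ldistr[symmetric])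
        (auto simp: Skew_mult weighted_sum_def H_def[symmetric])
  qed (auto intro!: finsum_closed)
  also have "\<dots> = (\<Oplus>h\<in>H. \<Oplus>g\<in>F. f h \<otimes> \<alpha> h (f' (inv\<^bsub>G\<^esub> h \<otimes>\<^bsub>G\<^esub> g)) \<otimes> w g)"
    using H F by (intro finsum_swap) auto
  also have "\<dots> = (\<Oplus>h\<in>H. f h \<otimes> \<alpha> h (weighted_sum f' (v h)))"
    using inner by (intro finsum_cong') (auto simp: weighted_sum_closed)
  finally show ?thesis by (simp add: weighted_sum_def H_def)
qed

lemma Skew_simps:
  "\<one>\<^bsub>Skew\<^esub> = single \<one> \<one>\<^bsub>G\<^esub>"
  "\<zero>\<^bsub>Skew\<^esub> = (\<lambda>x. \<zero>)"
  "f \<oplus>\<^bsub>Skew\<^esub> f' = (\<lambda>x. f x \<oplus> f' x)"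
  by (simp_all add: skew_group_ring_def single_def)

lemma SkewMod_simps [simp]:
  "carrier SkewMod = carrier A"
  "x \<oplus>\<^bsub>SkewMod\<^esub> y = x \<oplus> y"
  "\<zero>\<^bsub>SkewMod\<^esub> = \<zero>"
  "f \<odot>\<^bsub>SkewMod\<^esub> x = weighted_sum f (\<lambda>g. \<alpha> g x)"
  by (simp_all add: skew_group_module_def weighted_sum_def)

lemma Skew_ring: "ring Skew"
proof (rule ringI)
  show "abelian_group Skew"
  proof (rule abelian_groupI)
    fix f assume f: "f \<in> carrier Skew"
    have neg: "\<ominus> f g = \<zero> \<longleftrightarrow> f g = \<zero>" for g
      using f by (metis Skew_coeff minus_minus minus_zero)
    then have "(\<lambda>g. \<ominus> f g) \<in> carrier Skew" using f by (simp add: Skew_iff)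
    then show "\<exists>y\<in>carrier Skew. y \<oplus>\<^bsub>Skew\<^esub> f = \<zero>\<^bsub>Skew\<^esub>"
      using f by (intro bexI[of _ "\<lambda>g. \<ominus> f g"]) (auto simp: Skew_simps l_neg)
  qed (auto simp: Skew_simps Skew_add_closed a_ac, simp add: Skew_iff)
  show "Group.monoid Skew"
  proof (rule Group.monoidI)
    fix f f' assume f: "f \<in> carrier Skew" and f': "f' \<in> carrier Skew"
    show "f \<otimes>\<^bsub>Skew\<^esub> f' \<in> carrier Skew" using f f' by (rule Skew_mult_closed)
  next
    show "\<one>\<^bsub>Skew\<^esub> \<in> carrier Skew" by (simp add: Skew_simps single_closed)
  next
    fix f f' f'' assume f: "f \<in> carrier Skew" "f' \<in> carrier Skew" "f'' \<in> carrier Skew"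
    show "f \<otimes>\<^bsub>Skew\<^esub> f' \<otimes>\<^bsub>Skew\<^esub> f'' = f \<otimes>\<^bsub>Skew\<^esub> (f' \<otimes>\<^bsub>Skew\<^esub> f'')"
    proof
      fix x
      show "(f \<otimes>\<^bsub>Skew\<^esub> f' \<otimes>\<^bsub>Skew\<^esub> f'') x = (f \<otimes>\<^bsub>Skew\<^esub> (f' \<otimes>\<^bsub>Skew\<^esub> f'')) x"
      proof (cases "x \<in> carrier G")
        case False
        then show ?thesis using f by (simp add: Skew_mult Skew_mult_closed)
      next
        case True
        let ?v = "\<lambda>h k. \<alpha> k (f'' (inv\<^bsub>G\<^esub> k \<otimes>\<^bsub>G\<^esub> (inv\<^bsub>G\<^esub> h \<otimes>\<^bsub>G\<^esub> x)))"
        have "(f \<otimes>\<^bsub>Skew\<^esub> f' \<otimes>\<^bsub>Skew\<^esub> f'') x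
            = weighted_sum (f \<otimes>\<^bsub>Skew\<^esub> f') (\<lambda>g. \<alpha> g (f'' (inv\<^bsub>G\<^esub> g \<otimes>\<^bsub>G\<^esub> x)))"
          using f True by (simp add: Skew_mult[OF Skew_mult_closed])
        also have "\<dots> = weighted_sum f (\<lambda>h. \<alpha> h (weighted_sum f' (?v h)))"
          using f True by (intro weighted_sum_mult shifted_weight)
            (auto simp: act_mult G.inv_mult_group G.m_assoc)
        also have "\<dots> = weighted_sum f (\<lambda>h. \<alpha> h ((f' \<otimes>\<^bsub>Skew\<^esub> f'') (inv\<^bsub>G\<^esub> h \<otimes>\<^bsub>G\<^esub> x)))"
          using f True by (intro weighted_sum_cong)
            (auto simp: Skew_mult Skew_mult_closed intro!: act_closed weighted_sum_closed)
        also have "\<dots> = (f \<otimes>\<^bsub>Skew\<^esub> (f' \<otimes>\<^bsub>Skew\<^esub> f'')) x"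
          using f True by (simp add: Skew_mult[of f] Skew_mult_closed)
        finally show ?thesis .
      qed
    qed
  next
    fix f assume f: "f \<in> carrier Skew"
    have supp: "f x = \<zero>" if "x \<notin> carrier G" for x using that f by (auto simp: Skew_iff)
    have one: "single \<one> \<one>\<^bsub>G\<^esub> \<in> carrier Skew" by (simp add: single_closed)
    show "\<one>\<^bsub>Skew\<^esub> \<otimes>\<^bsub>Skew\<^esub> f = f"
    proof
      fix x
      show "(\<one>\<^bsub>Skew\<^esub> \<otimes>\<^bsub>Skew\<^esub> f) x = f x"
      proof (cases "x \<in> carrier G")
        case True
        then show ?thesis
          using f by (simp add: Skew_simps(1) Skew_mult[OF one f] weighted_sum_single[OF _ _ shifted_weight] act_one)
      qed (simp add: Skew_simps(1) Skew_mult[OF one f] supp)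
    qed
    show "f \<otimes>\<^bsub>Skew\<^esub> \<one>\<^bsub>Skew\<^esub> = f"
    proof
      fix x
      show "(f \<otimes>\<^bsub>Skew\<^esub> \<one>\<^bsub>Skew\<^esub>) x = f x"
      proof (cases "x \<in> carrier G")
        case False
        then show ?thesis by (simp add: Skew_simps(1) Skew_mult[OF f one] supp)
      next
        case True
        let ?F = "insert x {g. f g \<noteq> \<zero>}"
        have F: "finite ?F" "?F \<subseteq> carrier G" using f True by (auto simp: Skew_iff)
        have "(f \<otimes>\<^bsub>Skew\<^esub> \<one>\<^bsub>Skew\<^esub>) x
            = weighted_sum f (\<lambda>g. \<alpha> g (single \<one> \<one>\<^bsub>G\<^esub> (inv\<^bsub>G\<^esub> g \<otimes>\<^bsub>G\<^esub> x)))"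
          using True by (simp add: Skew_simps(1) Skew_mult[OF f one])
        also have "\<dots> = (\<Oplus>g\<in>?F. f g \<otimes> \<alpha> g (single \<one> \<one>\<^bsub>G\<^esub> (inv\<^bsub>G\<^esub> g \<otimes>\<^bsub>G\<^esub> x)))"
          using F by (intro weighted_sum_superset[OF f shifted_weight[OF one True]]) auto
        also have "\<dots> = (\<Oplus>g\<in>?F. if x = g then f g else \<zero>)"
        proof (rule finsum_cong')
          fix g assume "g \<in> ?F"
          then have g: "g \<in> carrier G" using F by auto
          have "inv\<^bsub>G\<^esub> g \<otimes>\<^bsub>G\<^esub> x = \<one>\<^bsub>G\<^esub> \<longleftrightarrow> x = g"
            using g True by (metis G.inv_solve_left' G.l_inv G.one_closed G.r_one)
          then show "f g \<otimes> \<alpha> g (single \<one> \<one>\<^bsub>G\<^esub> (inv\<^bsub>G\<^esub> g \<otimes>\<^bsub>G\<^esub> x)) = (if x = g then f g else \<zero>)"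
            using g f ring_hom_one[OF act_hom[OF g]] by (simp add: single_def)
        qed (use f in auto)
        also have "\<dots> = f x"
          using f F(1) by (intro finsum_singleton) auto
        finally show ?thesis .
      qed
    qed
  qed
next
  fix f f' f'' assume f: "f \<in> carrier Skew" "f' \<in> carrier Skew" "f'' \<in> carrier Skew"
  note sum = Skew_add_closed[OF f(1,2)]
  show "(f \<oplus>\<^bsub>Skew\<^esub> f') \<otimes>\<^bsub>Skew\<^esub> f'' = f \<otimes>\<^bsub>Skew\<^esub> f'' \<oplus>\<^bsub>Skew\<^esub> f' \<otimes>\<^bsub>Skew\<^esub> f''"
    unfolding Skew_simps(3)
    by (simp add: fun_eq_iff Skew_mult[OF sum f(3)] Skew_mult[OF f(1) f(3)] Skew_mult[OF f(2) f(3)]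
        weighted_sum_add_left[OF f(1,2) shifted_weight[OF f(3)]])
  show "f'' \<otimes>\<^bsub>Skew\<^esub> (f \<oplus>\<^bsub>Skew\<^esub> f') = f'' \<otimes>\<^bsub>Skew\<^esub> f \<oplus>\<^bsub>Skew\<^esub> f'' \<otimes>\<^bsub>Skew\<^esub> f'"
  proof
    fix x
    let ?w = "\<lambda>f g. \<alpha> g (f (inv\<^bsub>G\<^esub> g \<otimes>\<^bsub>G\<^esub> x))"
    have "weighted_sum f'' (?w (\<lambda>g. f g \<oplus> f' g)) = weighted_sum f'' (?w f) \<oplus> weighted_sum f'' (?w f')"
      if x: "x \<in> carrier G"
    proof -
      have "weighted_sum f'' (?w (\<lambda>g. f g \<oplus> f' g)) = weighted_sum f'' (\<lambda>g. ?w f g \<oplus> ?w f' g)"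
        using f x by (intro weighted_sum_cong) (auto simp: ring_hom_add[OF act_hom])
      also have "\<dots> = weighted_sum f'' (?w f) \<oplus> weighted_sum f'' (?w f')"
        by (rule weighted_sum_add_right[OF f(3) shifted_weight[OF f(1) x] shifted_weight[OF f(2) x]])
      finally show ?thesis .
    qed
    then show "(f'' \<otimes>\<^bsub>Skew\<^esub> (f \<oplus>\<^bsub>Skew\<^esub> f')) x = (f'' \<otimes>\<^bsub>Skew\<^esub> f \<oplus>\<^bsub>Skew\<^esub> f'' \<otimes>\<^bsub>Skew\<^esub> f') x"
      unfolding Skew_simps(3)
      by (simp add: Skew_mult[OF f(3) sum] Skew_mult[OF f(3) f(1)] Skew_mult[OF f(3) f(2)])
  qed
qed

lemma SkewMod_left_module: "left_module Skew SkewMod"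
proof (intro left_module.intro left_module_axioms.intro)
  show "ring Skew" by (rule Skew_ring)
  show "abelian_group SkewMod"
    by (rule abelian_groupI) (auto simp: a_ac intro: l_neg a_inv_closed)
next
  fix f x assume "f \<in> carrier Skew" "x \<in> carrier SkewMod"
  then show "f \<odot>\<^bsub>SkewMod\<^esub> x \<in> carrier SkewMod" by (auto intro!: weighted_sum_closed)
next
  fix f f' x assume "f \<in> carrier Skew" "f' \<in> carrier Skew" "x \<in> carrier SkewMod"
  then show "(f \<oplus>\<^bsub>Skew\<^esub> f') \<odot>\<^bsub>SkewMod\<^esub> x = f \<odot>\<^bsub>SkewMod\<^esub> x \<oplus>\<^bsub>SkewMod\<^esub> f' \<odot>\<^bsub>SkewMod\<^esub> x"
    by (auto simp: Skew_simps intro!: weighted_sum_add_left)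
  show "(f \<otimes>\<^bsub>Skew\<^esub> f') \<odot>\<^bsub>SkewMod\<^esub> x = f \<odot>\<^bsub>SkewMod\<^esub> (f' \<odot>\<^bsub>SkewMod\<^esub> x)"
    using \<open>f \<in> carrier Skew\<close> \<open>f' \<in> carrier Skew\<close> \<open>x \<in> carrier SkewMod\<close>
    by (simp, intro weighted_sum_mult) (auto simp: act_mult)
next
  fix f x y assume f: "f \<in> carrier Skew" "x \<in> carrier SkewMod" "y \<in> carrier SkewMod"
  have "weighted_sum f (\<lambda>g. \<alpha> g (x \<oplus> y)) = weighted_sum f (\<lambda>g. \<alpha> g x \<oplus> \<alpha> g y)"
    using f by (intro weighted_sum_cong) (auto simp: ring_hom_add[OF act_hom])
  then show "f \<odot>\<^bsub>SkewMod\<^esub> (x \<oplus>\<^bsub>SkewMod\<^esub> y) = f \<odot>\<^bsub>SkewMod\<^esub> x \<oplus>\<^bsub>SkewMod\<^esub> f \<odot>\<^bsub>SkewMod\<^esub> y"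
    using f by (auto intro!: weighted_sum_add_right)
next
  fix x assume "x \<in> carrier SkewMod"
  then show "\<one>\<^bsub>Skew\<^esub> \<odot>\<^bsub>SkewMod\<^esub> x = x"
    using weighted_sum_single[of \<one> "\<one>\<^bsub>G\<^esub>" "\<lambda>g. \<alpha> g x"] by (simp add: Skew_simps act_one)
qed

text \<open>The elements \<open>a g\<close> act by \<open>p \<mapsto> a (\<alpha> g p)\<close> and generate the skew group ring additively.\<close>

lemma submodule_SkewMod_iff:
  "submodule N Skew SkewMod \<longleftrightarrow> N \<subseteq> carrier A \<and> \<zero> \<in> N \<and> (\<forall>x\<in>N. \<forall>y\<in>N. x \<oplus> y \<in> N) \<and>
    (\<forall>a\<in>carrier A. \<forall>x\<in>N. a \<otimes> x \<in> N) \<and> (\<forall>g\<in>carrier G. \<forall>x\<in>N. \<alpha> g x \<in> N)"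
  (is "?L \<longleftrightarrow> ?R")
proof
  assume sub: ?L
  have subg: "subgroup N (add_monoid SkewMod)" using sub by (rule submodule.axioms(1))
  have N: "N \<subseteq> carrier A" using subgroup.subset[OF subg] by simp
  have smult: "a \<otimes> \<alpha> g x \<in> N" if "a \<in> carrier A" "g \<in> carrier G" "x \<in> N" for a g x
  proof -
    have "single a g \<odot>\<^bsub>SkewMod\<^esub> x \<in> N" using that by (intro submodule.smult_closed[OF sub] single_closed)
    then show ?thesis using that N by (auto simp: weighted_sum_single Pi_iff subset_iff)
  qed
  show ?R
  proof (intro conjI ballI)
    show "\<zero> \<in> N" using subgroup.one_closed[OF subg] by simp
    show "x \<oplus> y \<in> N" if "x \<in> N" "y \<in> N" for x y using subgroup.m_closed[OF subg that] by simp
    show "a \<otimes> x \<in> N" if "a \<in> carrier A" "x \<in> N" for a x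
      using smult[of a "\<one>\<^bsub>G\<^esub>" x] that N by (auto simp: act_one subset_iff)
    show "\<alpha> g x \<in> N" if "g \<in> carrier G" "x \<in> N" for g x
      using smult[of \<one> g x] that N by (auto simp: subset_iff)
  qed (fact N)
next
  assume R: ?R
  interpret M: left_module Skew SkewMod by (rule SkewMod_left_module)
  have sum: "finsum A t F \<in> N" if "finite F" "\<And>i. i \<in> F \<Longrightarrow> t i \<in> N" for t and F :: "'g set"
    using that R
  proof (induction F rule: finite_induct)
    case (insert i F)
    then have "t \<in> F \<rightarrow> carrier A" "t i \<in> carrier A" by (auto simp: subset_iff)
    then show ?case using insert by simp
  qed simp
  have smult: "f \<odot>\<^bsub>SkewMod\<^esub> x \<in> N" if "f \<in> carrier Skew" "x \<in> N" for f x
    using that R by (auto simp: weighted_sum_def Skew_iff intro!: sum)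
  have neg: "\<ominus> x \<in> N" if "x \<in> N" for x
  proof -
    have "\<ominus> \<one> \<otimes> x \<in> N" using that R by simp
    moreover have "x \<in> carrier A" using that R by blast
    ultimately show ?thesis by (simp add: l_minus)
  qed
  show ?L
  proof (intro submodule.intro submodule_axioms.intro)
    have inv: "inv\<^bsub>add_monoid SkewMod\<^esub> x = \<ominus> x" if "x \<in> N" for x
      using that R neg[OF that]
      by (intro comm_monoid.comm_inv_char[OF M.M.a_comm_monoid]) (auto simp: r_neg subset_iff)
    show "subgroup N (add_monoid SkewMod)"
    proof (rule subgroup.intro)
      show "inv\<^bsub>add_monoid SkewMod\<^esub> x \<in> N" if "x \<in> N" for x
        by (simp only: inv[OF that] neg[OF that])
    qed (use R in auto)
    show "f \<odot>\<^bsub>SkewMod\<^esub> x \<in> N" if "f \<in> carrier Skew" "x \<in> N" for f x using that by (rule smult)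
  qed
qed

end

section \<open>The Noetherian property\<close>

theorem corollary1p5:
  fixes k :: "('a, 'm) ring_scheme"
    and S :: "'s set"
    and G :: "('g, 'n) monoid_scheme"
    and \<rho> :: "'g \<Rightarrow> 's \<Rightarrow> 's"
  assumes "cring k" and "noetherian_ring k"
    and "group G"
    and "group_action G S \<rho>"
    and "highly_homogeneous G S \<rho>"
  shows "noetherian_left_module
    (skew_group_ring (ring.indexed_poly_ring k S) G (\<lambda>g. ring.indexed_rename k (\<rho> g)))
    (skew_group_module (ring.indexed_poly_ring k S) (\<lambda>g. ring.indexed_rename k (\<rho> g)))"
proof -
  interpret k: cring k by fact
  interpret H: highly_homogeneous_action G S \<rho>
    using assms by (simp add: highly_homogeneous_action_def highly_homogeneous_action_axioms_def)
  let ?A = "k.indexed_poly_ring S"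
  let ?P = "\<lambda>V. k.indexed_pset V (carrier k)"
  let ?\<alpha> = "\<lambda>g. k.indexed_rename (\<rho> g)"
  interpret A: cring ?A by (rule k.indexed_poly_ring_cring)
  interpret act: group_acting_on_ring ?A G ?\<alpha>
  proof (intro group_acting_on_ring.intro group_acting_on_ring_axioms.intro)
    show "ring ?A" by (rule A.ring_axioms)
    show "group G" by fact
    show "?\<alpha> g \<in> ring_hom ?A ?A" if "g \<in> carrier G" for g
      using H.inj_prop[OF that] H.surj_prop[OF that] by (intro k.indexed_rename_ring_hom) auto
    show "?\<alpha> \<one>\<^bsub>G\<^esub> p = p" if "p \<in> carrier ?A" for p
      using that by (intro k.indexed_rename_ident[of _ S]) (auto simp: H.id_eq_one[symmetric])
    show "?\<alpha> (g \<otimes>\<^bsub>G\<^esub> h) p = ?\<alpha> g (?\<alpha> h p)" if "g \<in> carrier G" "h \<in> carrier G" "p \<in> carrier ?A" for g h p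
    proof -
      have p: "p \<in> ?P S" using that(3) by simp
      have "?\<alpha> (g \<otimes>\<^bsub>G\<^esub> h) p = k.indexed_rename (\<rho> g \<circ> \<rho> h) p"
        using that by (intro k.indexed_rename_cong[OF p]) (simp add: H.composition_rule)
      also have "\<dots> = ?\<alpha> g (?\<alpha> h p)"
        using H.inj_prop H.surj_prop that by (intro k.indexed_rename_comp[OF p, symmetric]) auto
      finally show ?thesis .
    qed
  qed
  have "\<exists>C\<subseteq>carrier act.SkewMod. finite C \<and> N = submodule_generated act.Skew act.SkewMod C"
    if N: "submodule N act.Skew act.SkewMod" for N
  proof -
    obtain Ls :: "nat set" and t where Ls: "Ls \<noteq> {} \<and> inj_on t (\<Union>l\<in>Ls. {..<l}) \<and> t ` (\<Union>l\<in>Ls. {..<l}) \<subseteq> S \<and>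
      (\<forall>l\<in>Ls. \<forall>l'\<in>Ls. \<forall>f. strict_mono_on {..<l} f \<and> f ` {..<l} \<subseteq> {..<l'} \<longrightarrow>
        (\<exists>g\<in>carrier G. \<forall>i<l. \<rho> g (t i) = t (f i))) \<and>
      (\<forall>V. finite V \<and> V \<subseteq> S \<longrightarrow> (\<exists>g\<in>carrier G. \<rho> g ` V \<subseteq> t ` (\<Union>l\<in>Ls. {..<l})))"
      using H.coordinate_sequence by (elim exE) (rule that)
    define D where "D = (\<Union>l\<in>Ls. {..<l})"
    have ne: "Ls \<noteq> {}" using Ls by simp
    have t: "inj_on t D" "t ` D \<subseteq> S" using Ls by (simp_all add: D_def)
    have shift: "\<exists>g\<in>carrier G. \<forall>i<l. \<rho> g (t i) = t (f i)"
      if "l \<in> Ls" "l' \<in> Ls" "strict_mono_on {..<l} f" "f ` {..<l} \<subseteq> {..<l'}" for l l' f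
      using Ls that by blast
    have move: "\<exists>g\<in>carrier G. \<rho> g ` V \<subseteq> t ` D" if "finite V" "V \<subseteq> S" for V
      using Ls that by (simp add: D_def)
    \<comment> \<open>The trace of N on the polynomials in the variables indexed by D; a renaming of the
      variables by a shift becomes the action of some group element on N.\<close>
    define J where "J N = {q \<in> ?P D. k.indexed_rename t q \<in> N}" for N
    have J: "k.shift_ideal Ls (J N)" if N: "submodule N act.Skew act.SkewMod" for N
      unfolding k.shift_ideal_def D_def[symmetric]
    proof (intro conjI ballI allI impI)
      note N' = N[unfolded act.submodule_SkewMod_iff]
      have "ideal N ?A"
      proof (rule idealI)
        show "ring ?A" by (rule A.ring_axioms)
        show "subgroup N (add_monoid ?A)"
        proof (rule A.add.subgroupI)
          show "\<ominus>\<^bsub>?A\<^esub> p \<in> N" if "p \<in> N" for p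
          proof -
            have "\<ominus>\<^bsub>?A\<^esub> \<one>\<^bsub>?A\<^esub> \<otimes>\<^bsub>?A\<^esub> p \<in> N" using that N' A.a_inv_closed[OF A.one_closed] by blast
            moreover have "p \<in> carrier ?A" using that N' by blast
            ultimately show ?thesis by (simp only: A.l_minus A.l_one A.one_closed)
          qed
        qed (use N' in auto)
        show mult: "x \<otimes>\<^bsub>?A\<^esub> p \<in> N" if "p \<in> N" "x \<in> carrier ?A" for p x
          using that N' by blast
        show "p \<otimes>\<^bsub>?A\<^esub> x \<in> N" if p: "p \<in> N" "x \<in> carrier ?A" for p x
        proof -
          have "p \<in> carrier ?A" using p(1) N' by blast
          then show ?thesis using mult[OF p] p(2) by (simp only: A.m_comm)
        qed
      qed
      then have "ideal {q \<in> carrier (k.indexed_poly_ring D). k.indexed_rename t q \<in> N} (k.indexed_poly_ring D)"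
        by (rule ring_hom_ring.ideal_vimage[OF ring_hom_ringI2[OF cring.axioms(1)[OF k.indexed_poly_ring_cring]
            A.ring_axioms k.indexed_rename_ring_hom[OF t]]])
      then show "ideal (J N) (k.indexed_poly_ring D)" by (simp add: J_def)
    next
      fix l l' f p
      assume l: "l \<in> Ls" "l' \<in> Ls" and fp: "strict_mono_on {..<l} f \<and> f ` {..<l} \<subseteq> {..<l'} \<and> p \<in> J N \<inter> ?P {..<l}"
      then have f: "strict_mono_on {..<l} f" "f ` {..<l} \<subseteq> {..<l'}"
        and p: "p \<in> ?P {..<l}" "k.indexed_rename t p \<in> N" by (simp_all add: J_def)
      have inj: "inj_on f {..<l}" using f(1) by (rule strict_mono_on_imp_inj_on)
      have sub: "{..<l} \<subseteq> D" "{..<l'} \<subseteq> D" using l by (auto simp: D_def)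
      obtain g where g: "g \<in> carrier G" "\<forall>i<l. \<rho> g (t i) = t (f i)"
        using shift[OF l f] by blast
      have "k.indexed_rename t (k.indexed_rename f p) = k.indexed_rename (t \<circ> f) p"
        using p(1) inj f(2) inj_on_subset[OF t(1) sub(2)] by (rule k.indexed_rename_comp)
      also have "\<dots> = k.indexed_rename (\<rho> g \<circ> t) p"
        using p(1) g(2) by (intro k.indexed_rename_cong) auto
      also have "\<dots> = ?\<alpha> g (k.indexed_rename t p)"
        using p(1) inj_on_subset[OF t(1) sub(1)] subset_trans[OF image_mono[OF sub(1)] t(2)] H.inj_prop[OF g(1)]
        by (rule k.indexed_rename_comp[symmetric])
      finally have "k.indexed_rename t (k.indexed_rename f p) \<in> N"
        using N g(1) p(2) unfolding act.submodule_SkewMod_iff by simp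
      moreover have "k.indexed_rename f p \<in> ?P D"
        using p(1) inj f(2) sub(2) by (intro k.indexed_rename_closed) auto
      ultimately show "k.indexed_rename f p \<in> J N" by (simp add: J_def)
    qed
    obtain B where B: "B \<subseteq> J N" "finite B"
      and gen: "\<forall>J'. k.shift_ideal Ls J' \<and> B \<subseteq> J' \<longrightarrow> J N \<subseteq> J'"
      using k.shift_ideal_finitely_generated[OF assms(2) ne J[OF N]] by (elim exE conjE) (rule that)
    let ?C = "k.indexed_rename t ` B"
    have C: "?C \<subseteq> N" using B(1) by (auto simp: J_def)
    have "N \<subseteq> N'" if N': "submodule N' act.Skew act.SkewMod" and sub: "?C \<subseteq> N'" for N'
    proof
      fix p assume p: "p \<in> N"
      have p_S: "p \<in> ?P S" using p N unfolding act.submodule_SkewMod_iff by auto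
      \<comment> \<open>Move the finitely many variables of p into the image of t, so that J N controls the
        translate u of p, and move back afterwards.\<close>
      define V where "V = (\<Union>m\<in>{m. p m \<noteq> \<zero>\<^bsub>k\<^esub>}. set_mset m)"
      have V: "finite V" "V \<subseteq> S" "p \<in> ?P V" using p_S by (auto simp: V_def k.indexed_pset_iff)
      obtain g where g: "g \<in> carrier G" "\<rho> g ` V \<subseteq> t ` D" using move[OF V(1,2)] by blast
      define u where "u = ?\<alpha> g p"
      have u: "u \<in> ?P (t ` D)" unfolding u_def
        using V(3) inj_on_subset[OF H.inj_prop[OF g(1)] V(2)] g(2) by (rule k.indexed_rename_closed)
      have u_N: "u \<in> N" using p g(1) N unfolding u_def act.submodule_SkewMod_iff by blast
      define q where "q = k.indexed_rename (inv_into D t) u"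
      have q: "q \<in> ?P D" unfolding q_def
        using u by (rule k.indexed_rename_closed) (auto simp: inj_on_inv_into t(1))
      have "k.indexed_rename t q = k.indexed_rename (t \<circ> inv_into D t) u"
        unfolding q_def using u t(1) by (intro k.indexed_rename_comp[of _ _ _ D]) (auto simp: inj_on_inv_into)
      also have "\<dots> = u" using u by (rule k.indexed_rename_ident) (auto simp: t(1) f_inv_into_f)
      finally have q_u: "k.indexed_rename t q = u" .
      have "B \<subseteq> J N'" using B(1) sub by (auto simp: J_def)
      with J[OF N'] have "J N \<subseteq> J N'" by (intro gen[rule_format]) (rule conjI)
      then have "u \<in> N'" using q q_u u_N by (auto simp: J_def)
      then have "?\<alpha> (inv\<^bsub>G\<^esub> g) u \<in> N'"
        using N' g(1) unfolding act.submodule_SkewMod_iff by simp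
      moreover have "?\<alpha> (inv\<^bsub>G\<^esub> g) u = p"
        using act.act_mult[of "inv\<^bsub>G\<^esub> g" g p] act.act_one[of p] g(1) p_S by (simp add: u_def)
      ultimately show "p \<in> N'" by simp
    qed
    then have "N = submodule_generated act.Skew act.SkewMod ?C"
      using N C unfolding submodule_generated_def by blast
    moreover have "?C \<subseteq> carrier act.SkewMod"
      using C N unfolding act.submodule_SkewMod_iff by auto
    ultimately show ?thesis using B(2) by (intro exI[of _ ?C]) auto
  qed
  then show ?thesis
    by (intro noetherian_left_module.intro noetherian_left_module_axioms.intro act.SkewMod_left_module)
qed

end
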